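(* Let $N\in\mathbb{N}$, $N\ge 1$, and for $i=1,\dots,N$ let $b_i\in\mathbb{R}\setminus\{0\}$, $q_i\in\mathbb{R}$, $r_i\in\mathbb{R}_{>0}$, and set $\sigma_i:=\frac{b_i^2 q_i}{r_i}$. Assume the players are ordered such that $\sigma_1\ge\sigma_2\ge\dots\ge\sigma_N$, and assume $\sigma_N>-1$. For $a\in\mathbb{R}$ consider the scalar $N$-player linear quadratic dynamic game with dynamics $x(k+1)=a x(k)+\sum_{i=1}^N b_i u_i(k)$, $x(0)=x_0$, and costs $J_i=\sum_{k=0}^\infty\left(q_i x(k)^2+r_i u_i(k)^2\right)$, $i=1,\dots,N$, and its feedback Nash equilibria (FNE) as defined in the context. Then the following hold. (i) For all $a$ with $|a|$ sufficiently large (i.e. there is $A>0$, depending on $N$ and the $b_i,q_i,r_i$, such that for all $a$ with $|a|>A$), the game has exactly $2^N-1$ FNE. (ii) If $\sigma_1>0$, then for every $a\in\mathbb{R}$ the game has at least one FNE. (iii) Suppose $\sigma_1>0$ and there exists at least one index $j\in\{1,\dots,N\}$ with $\sigma_j>0$ and $\sigma_j\ne\sigma_i$ for all $i\in\{1,\dots,N\}$, $i\neq j$; let $\bar\sigma$ be the maximum of $\sigma_j$ over all such indices $j$. Then for every $a\in\mathbb{R}$ and every FNE $(k_1,\dots,k_N)$ of the game, the closed-loop parameter $a_{cl}^\star=a+\sum_{j=1}^N b_jk_j$ satisfies $|a_{cl}^\star|\le\left|\sqrt{\bar\sigma}-\sqrt{\bar\sigma+1}\right|$. (iv) If $\sigma_N\ge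 0$ and $|a|<1$, then the game has a unique FNE. (v) Suppose $\sigma_N<0$, $\sigma_1>0$ and $\sigma_1>\sigma_2$. If $$\sum_{i=2}^N\sqrt{\sigma_1-\sigma_i}<(N-1)\sqrt{\sigma_1}+\sqrt{\sigma_1+1}$$ and $$(N-1)+\frac{|\xi|}{\sqrt{\xi^2+1}}<\sum_{i=1}^N\frac{|\xi|}{\sqrt{\xi^2-\sigma_i}}\quad\text{for all }\xi\in\mathbb{R}\text{ with }|\xi|>\sqrt{\sigma_1},$$ then for all $a$ with $|a|$ sufficiently small (i.e. there is $\varepsilon>0$, depending on $N$ and the $b_i,q_i,r_i$, such that for all $a$ with $|a|<\varepsilon$) the game has a unique FNE. (vi) Suppose $\sigma_1\le 0$. If $$\left(\sum_{i=2}^N\sqrt{-\sigma_i}\right)-\sqrt{-\sigma_1}<1$$ and $$(N-1)+\frac{|\xi|}{\sqrt{\xi^2+1}}\neq\sum_{i=1}^N\frac{|\xi|}{\sqrt{\xi^2-\sigma_i}}\quad\text{for all }\xi\in\mathbb{R}\setminus\{0\},$$ then for all $a$ with $|a|$ sufficiently small (in the same sense as in (v)) the game has a unique FNE. (vii) If $\sigma_1=\dots=\sigma_N=0$ and $|a|=1$, then the game has no FNE.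
   Context: Game: the state $x(k)\in\mathbb{R}$ and the inputs $u_i(k)\in\mathbb{R}$, $i=1,\dots,N$, are scalar; player $i$ chooses $u_i$ and wishes to minimise $J_i(x_0,u_1,\dots,u_N)=\sum_{k=0}^\infty(q_ix(k)^2+r_iu_i(k)^2)$ (note that $q_i$ may be negative). Strategies: only linear static state-feedback strategies $u_i(k)=k_i x(k)$ with gains $k_i\in\mathbb{R}$ are considered. A set of strategies with gains $(k_1,\dots,k_N)\in\mathbb{R}^N$ is admissible if it renders the zero equilibrium of the system asymptotically stable, i.e. if $|a_{cl}|<1$, where $a_{cl}:=a+\sum_{j=1}^N b_jk_j$. Feedback Nash equilibrium (FNE): an admissible set of strategies, given by gains $(k_1,\dots,k_N)$, such that for each $i$ and each $\tilde k_i\in\mathbb{R}$ for which replacing $k_i$ by $\tilde k_i$ (all other gains unchanged) gives an admissible set of strategies, the cost $J_i$ under $(k_1,\dots,k_N)$ is less than or equal to the cost $J_i$ under the modified gains, for every initial condition $x_0\in\mathbb{R}$. FNE are identified with, and counted as, distinct gain tuples $(k_1,\dots,k_N)\in\mathbb{R}^N$. *)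

theory Defs
  imports Complex_Main "HOL-Library.FuncSet"
begin

text \<open>
  Players are the indices in \<open>{1..N}\<close>. A family indexed by players is a function
  of type \<open>nat \<Rightarrow> real\<close>; only its values on \<open>{1..N}\<close> matter.
\<close>

primrec state ::
  "nat \<Rightarrow> real \<Rightarrow> (nat \<Rightarrow> real) \<Rightarrow> real \<Rightarrow> (nat \<Rightarrow> nat \<Rightarrow> real) \<Rightarrow> nat \<Rightarrow> real"
where
  "state N a b x0 u 0 = x0"
| "state N a b x0 u (Suc t) = a * state N a b x0 u t + (\<Sum>i=1..N. b i * u i t)"

text \<open>
  The infinite sum is meaningful only for summable stage costs. This is the case for all
  admissible feedback strategies, see \<open>stage_cost_summable\<close> below.
\<close>

definition cost ::
  "nat \<Rightarrow> real \<Rightarrow> (nat \<Rightarrow> real) \<Rightarrow> (nat \<Rightarrow> real) \<Rightarrow> (nat \<Rightarrow> real) \<Rightarrow> nat \<Rightarrow> real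
    \<Rightarrow> (nat \<Rightarrow> nat \<Rightarrow> real) \<Rightarrow> real"
where
  "cost N a b q r i x0 u = (\<Sum>t. q i * (state N a b x0 u t)\<^sup>2 + r i * (u i t)\<^sup>2)"

primrec fb_state ::
  "nat \<Rightarrow> real \<Rightarrow> (nat \<Rightarrow> real) \<Rightarrow> (nat \<Rightarrow> real) \<Rightarrow> real \<Rightarrow> nat \<Rightarrow> real"
where
  "fb_state N a b K x0 0 = x0"
| "fb_state N a b K x0 (Suc t) =
     a * fb_state N a b K x0 t + (\<Sum>i=1..N. b i * (K i * fb_state N a b K x0 t))"

definition fb_input ::
  "nat \<Rightarrow> real \<Rightarrow> (nat \<Rightarrow> real) \<Rightarrow> (nat \<Rightarrow> real) \<Rightarrow> real \<Rightarrow> nat \<Rightarrow> nat \<Rightarrow> real"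
where
  "fb_input N a b K x0 i t = K i * fb_state N a b K x0 t"

definition fb_cost ::
  "nat \<Rightarrow> real \<Rightarrow> (nat \<Rightarrow> real) \<Rightarrow> (nat \<Rightarrow> real) \<Rightarrow> (nat \<Rightarrow> real) \<Rightarrow> nat \<Rightarrow> (nat \<Rightarrow> real)
    \<Rightarrow> real \<Rightarrow> real"
where
  "fb_cost N a b q r i K x0 = cost N a b q r i x0 (fb_input N a b K x0)"

definition closed_loop :: "nat \<Rightarrow> real \<Rightarrow> (nat \<Rightarrow> real) \<Rightarrow> (nat \<Rightarrow> real) \<Rightarrow> real" where
  "closed_loop N a b K = a + (\<Sum>j=1..N. b j * K j)"

definition admissible :: "nat \<Rightarrow> real \<Rightarrow> (nat \<Rightarrow> real) \<Rightarrow> (nat \<Rightarrow> real) \<Rightarrow> bool" where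
  "admissible N a b K \<longleftrightarrow> \<bar>closed_loop N a b K\<bar> < 1"

definition is_FNE ::
  "nat \<Rightarrow> real \<Rightarrow> (nat \<Rightarrow> real) \<Rightarrow> (nat \<Rightarrow> real) \<Rightarrow> (nat \<Rightarrow> real) \<Rightarrow> (nat \<Rightarrow> real) \<Rightarrow> bool"
where
  "is_FNE N a b q r K \<longleftrightarrow>
     admissible N a b K \<and>
     (\<forall>i\<in>{1..N}. \<forall>k'. admissible N a b (K(i := k')) \<longrightarrow>
        (\<forall>x0. fb_cost N a b q r i K x0 \<le> fb_cost N a b q r i (K(i := k')) x0))"

text \<open>
  Gain tuples in \<open>\<real>\<^sup>N\<close> are represented by the functions that are extensional on
  \<open>{1..N}\<close>, so that distinct elements of the following set are distinct tuples.
\<close>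

definition FNE ::
  "nat \<Rightarrow> real \<Rightarrow> (nat \<Rightarrow> real) \<Rightarrow> (nat \<Rightarrow> real) \<Rightarrow> (nat \<Rightarrow> real) \<Rightarrow> (nat \<Rightarrow> real) set"
where
  "FNE N a b q r = {K \<in> {1..N} \<rightarrow>\<^sub>E UNIV. is_FNE N a b q r K}"

lemma state_fb_input: "state N a b x0 (fb_input N a b K x0) t = fb_state N a b K x0 t"
  by (induction t) (simp_all add: fb_input_def)

lemma fb_state_eq: "fb_state N a b K x0 t = closed_loop N a b K ^ t * x0"
  by (induction t)
    (simp_all add: closed_loop_def algebra_simps sum_distrib_left sum_distrib_right)

lemma stage_cost_summable:
  assumes "admissible N a b K"
  shows "summable (\<lambda>t. q i * (state N a b x0 (fb_input N a b K x0) t)\<^sup>2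
           + r i * (fb_input N a b K x0 i t)\<^sup>2)"
proof -
  let ?c = "closed_loop N a b K"
  have "?c\<^sup>2 < 1"
    using assms by (simp add: admissible_def abs_square_less_1)
  then have "summable (\<lambda>t. (?c\<^sup>2) ^ t)"
    by (intro summable_geometric) simp
  then have "summable (\<lambda>t. ((q i + r i * (K i)\<^sup>2) * x0\<^sup>2) * (?c\<^sup>2) ^ t)"
    by (rule summable_mult)
  moreover have "(\<lambda>t. ((q i + r i * (K i)\<^sup>2) * x0\<^sup>2) * (?c\<^sup>2) ^ t) =
      (\<lambda>t. q i * (state N a b x0 (fb_input N a b K x0) t)\<^sup>2
           + r i * (fb_input N a b K x0 i t)\<^sup>2)"
  proof
    fix t
    have "(?c\<^sup>2) ^ t = (?c ^ t)\<^sup>2"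
      by (simp flip: power_mult add: mult.commute)
    then show "((q i + r i * (K i)\<^sup>2) * x0\<^sup>2) * (?c\<^sup>2) ^ t =
        q i * (state N a b x0 (fb_input N a b K x0) t)\<^sup>2
           + r i * (fb_input N a b K x0 i t)\<^sup>2"
      by (simp add: state_fb_input fb_input_def fb_state_eq power_mult_distrib algebra_simps)
  qed
  ultimately show ?thesis by simp
qed

text \<open>
  Admissibility is asymptotic stability (Lyapunov stability and local attractivity) of the
  zero equilibrium of the closed loop.
\<close>

lemma admissible_iff_asymptotically_stable:
  "admissible N a b K \<longleftrightarrow>
     (\<forall>e>0. \<exists>d>0. \<forall>x0. \<bar>x0\<bar> < d \<longrightarrow> (\<forall>t. \<bar>fb_state N a b K x0 t\<bar> < e)) \<and>
     (\<exists>d>0. \<forall>x0. \<bar>x0\<bar> < d \<longrightarrow> fb_state N a b K x0 \<longlonglongrightarrow> 0)"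
  (is "_ \<longleftrightarrow> ?S \<and> ?A")
proof
  let ?c = "closed_loop N a b K"
  assume "admissible N a b K"
  then have c: "\<bar>?c\<bar> < 1" by (simp add: admissible_def)
  have bound: "\<bar>fb_state N a b K x0 t\<bar> \<le> \<bar>x0\<bar>" for x0 t
  proof -
    have "\<bar>?c\<bar> ^ t \<le> 1" using c by (intro power_le_one) auto
    then have "\<bar>?c\<bar> ^ t * \<bar>x0\<bar> \<le> 1 * \<bar>x0\<bar>" by (rule mult_right_mono) simp
    then show ?thesis by (simp add: fb_state_eq abs_mult power_abs)
  qed
  have ?S using bound by (meson le_less_trans)
  moreover have "fb_state N a b K x0 \<longlonglongrightarrow> 0" for x0
  proof -
    have "(\<lambda>t. ?c ^ t * x0) \<longlonglongrightarrow> 0"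
      using c by (intro tendsto_mult_left_zero LIMSEQ_power_zero) simp
    then show ?thesis by (simp add: fb_state_eq[abs_def])
  qed
  then have ?A using zero_less_one by blast
  ultimately show "?S \<and> ?A" ..
next
  let ?c = "closed_loop N a b K"
  assume "?S \<and> ?A"
  then obtain d where d: "d > 0"
    and lim: "\<And>x0. \<bar>x0\<bar> < d \<Longrightarrow> fb_state N a b K x0 \<longlonglongrightarrow> 0" by blast
  have "fb_state N a b K (d/2) \<longlonglongrightarrow> 0" using d by (intro lim) simp
  then have "(\<lambda>t. \<bar>?c ^ t * (d/2)\<bar>) \<longlonglongrightarrow> 0"
    by (simp add: fb_state_eq[abs_def] tendsto_rabs_zero_iff)
  then have "\<forall>\<^sub>F t in sequentially. \<bar>?c ^ t * (d/2)\<bar> < d/2"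
    by (rule order_tendstoD(2)) (use d in simp)
  then obtain t where "\<bar>?c ^ t * (d/2)\<bar> < d/2"
    using eventually_happens'[OF sequentially_bot] by blast
  then have "\<bar>?c\<bar> ^ t < 1" using d by (simp add: abs_mult power_abs)
  then have "\<bar>?c\<bar> < 1" using one_le_power[of "\<bar>?c\<bar>" t] by linarith
  then show "admissible N a b K" by (simp add: admissible_def)
qed

end

theory Submission
  imports Defs "HOL-Real_Asymp.Real_Asymp"
begin

text \<open>
  Against fixed gains of the others, player \<open>i\<close> chooses the closed loop \<open>c \<in> (-1, 1)\<close> so as to minimise
  \<open>(\<sigma>\<^sub>i + (c - \<alpha>)\<^sup>2) / (1 - c\<^sup>2)\<close>, where \<open>\<alpha>\<close> is the loop without player \<open>i\<close>. As \<open>\<sigma>\<^sub>i > -1\<close>, stationary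
  points are exactly the minimisers, so the equilibria are the solutions of
  \<open>c \<kappa>\<^sub>i\<^sup>2 + (1 - c\<^sup>2) \<kappa>\<^sub>i + c \<sigma>\<^sub>i = 0\<close> with \<open>\<kappa>\<^sub>i = b\<^sub>i k\<^sub>i\<close> and \<open>\<bar>c\<bar> < 1\<close>. If \<open>c \<noteq> 0\<close>, put
  \<open>\<xi> = (1 - c\<^sup>2) / (2 c)\<close>; then \<open>\<kappa>\<^sub>i = - \<xi> \<plusminus> sqrt (\<xi>\<^sup>2 - \<sigma>\<^sub>i)\<close>, and the definition of \<open>c\<close> becomes one scalar
  equation between \<open>\<xi>\<close> and \<open>a\<close> for each choice \<open>S\<close> of negative roots. For \<open>S = {}\<close> its graph tends to 0 at
  infinity, for every other \<open>S\<close> it tends to infinity and is eventually increasing; counting the points on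
  these graphs at height \<open>\<plusminus>a\<close> gives all claims.
\<close>

section \<open>Best responses in one variable and costs in closed form\<close>

text \<open>With \<open>p\<close> the value of the quotient at \<open>c\<close>, clearing the
  positive denominator turns optimality into nonnegativity on (-1, 1) of the quadratic
  \<open>g\<close>, which vanishes at \<open>c\<close>. An interior minimum is critical, which reads
  \<open>\<alpha> = (1 + p) * c\<close>; conversely, this equation gives
  \<open>g d = (1 + p) * (d - c)\<^sup>2\<close>. The cubic condition is this equation multiplied by
  \<open>1 - c\<^sup>2\<close>.\<close>

lemma minimiser_iff:
  fixes s \<alpha> c :: real
  assumes "s > -1" and c: "\<bar>c\<bar> < 1"
  shows "(\<forall>d. \<bar>d\<bar> < 1 \<longrightarrow> (s + (c - \<alpha>)\<^sup>2) / (1 - c\<^sup>2) \<le> (s + (d - \<alpha>)\<^sup>2) / (1 - d\<^sup>2)) \<longleftrightarrow>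
    c * (c - \<alpha>)\<^sup>2 + (1 - c\<^sup>2) * (c - \<alpha>) + c * s = 0"
proof -
  have pos: "1 - d\<^sup>2 > 0" if "\<bar>d\<bar> < 1" for d :: real
    using that by (simp add: abs_square_less_1)
  define p where "p = (s + (c - \<alpha>)\<^sup>2) / (1 - c\<^sup>2)"
  have p: "p * (1 - c\<^sup>2) = s + (c - \<alpha>)\<^sup>2"
    using pos[OF c] by (simp add: p_def)
  define g where "g d = (1 + p) * d\<^sup>2 - 2 * \<alpha> * d + \<alpha>\<^sup>2 + s - p" for d
  have le_iff: "p \<le> (s + (d - \<alpha>)\<^sup>2) / (1 - d\<^sup>2) \<longleftrightarrow> 0 \<le> g d" if "\<bar>d\<bar> < 1" for d
    using pos[OF that] by (simp add: le_divide_eq g_def algebra_simps power2_eq_square)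
  have gc: "g c = 0"
    using p by (simp add: g_def algebra_simps power2_eq_square)
  have "c * (c - \<alpha>)\<^sup>2 + (1 - c\<^sup>2) * (c - \<alpha>) + c * s = (1 - c\<^sup>2) * ((1 + p) * c - \<alpha>)"
    using p by algebra
  then have stat: "c * (c - \<alpha>)\<^sup>2 + (1 - c\<^sup>2) * (c - \<alpha>) + c * s = 0 \<longleftrightarrow> \<alpha> = (1 + p) * c"
    using pos[OF c] by auto
  have "(\<forall>d. \<bar>d\<bar> < 1 \<longrightarrow> 0 \<le> g d) \<longleftrightarrow> \<alpha> = (1 + p) * c"
  proof
    assume nonneg: "\<forall>d. \<bar>d\<bar> < 1 \<longrightarrow> 0 \<le> g d"
    have "(g has_real_derivative (2 * (1 + p) * c - 2 * \<alpha>)) (at c)"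
      unfolding g_def by (auto intro!: derivative_eq_intros)
    moreover have "\<forall>d. \<bar>c - d\<bar> < 1 - \<bar>c\<bar> \<longrightarrow> g c \<le> g d"
      using nonneg gc by (auto simp: abs_if split: if_splits)
    ultimately have "2 * (1 + p) * c - 2 * \<alpha> = 0"
      using c by (intro DERIV_local_min[of g _ c "1 - \<bar>c\<bar>"]) auto
    then show "\<alpha> = (1 + p) * c" by (simp add: algebra_simps)
  next
    assume \<alpha>: "\<alpha> = (1 + p) * c"
    \<comment> \<open>The right-hand side is positive because \<open>s > -1\<close>; hence
      \<open>g\<close> opens upwards.\<close>
    have "(1 + p) * (1 + c\<^sup>2) = s + 1 + ((1 + p) * c)\<^sup>2"
      using p \<alpha> by algebra
    also have "\<dots> > 0" using assms(1) by (simp add: add_pos_nonneg)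
    finally have "1 + p > 0"
      by (meson add_pos_nonneg mult_less_0_iff not_less zero_le_power2 zero_less_mult_pos2 zero_less_one)
    moreover have "g d = (1 + p) * (d - c)\<^sup>2" for d
      using gc \<alpha> unfolding g_def by algebra
    ultimately show "\<forall>d. \<bar>d\<bar> < 1 \<longrightarrow> 0 \<le> g d" by simp
  qed
  with le_iff stat show ?thesis unfolding p_def by auto
qed

text \<open>The state is a geometric sequence, so the cost is a geometric series whose ratio is the
  squared closed loop.\<close>

lemma fb_cost_admissible:
  assumes "admissible N a b K"
  shows "fb_cost N a b q r i K x0 =
    (q i + r i * (K i)\<^sup>2) / (1 - (closed_loop N a b K)\<^sup>2) * x0\<^sup>2"
proof -
  let ?c = "closed_loop N a b K"
  have "?c\<^sup>2 < 1"
    using assms by (simp add: admissible_def abs_square_less_1)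
  then have "(\<lambda>t. ((q i + r i * (K i)\<^sup>2) * x0\<^sup>2) * (?c\<^sup>2) ^ t) sums
      (((q i + r i * (K i)\<^sup>2) * x0\<^sup>2) * (1 / (1 - ?c\<^sup>2)))"
    by (intro sums_mult geometric_sums) simp
  moreover have "((q i + r i * (K i)\<^sup>2) * x0\<^sup>2) * (?c\<^sup>2) ^ t =
      q i * (state N a b x0 (fb_input N a b K x0) t)\<^sup>2 + r i * (fb_input N a b K x0 i t)\<^sup>2" for t
    by (simp add: state_fb_input fb_input_def fb_state_eq power_mult_distrib algebra_simps
        flip: power_mult)
  ultimately show ?thesis
    unfolding fb_cost_def cost_def by (simp add: sums_iff)
qed

lemma closed_loop_upd:
  assumes "i \<in> {1..N}"
  shows "closed_loop N a b (K(i := k)) = closed_loop N a b K - b i * K i + b i * k"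
proof -
  have "(\<Sum>j\<in>{1..N} - {i}. b j * (K(i := k)) j) = (\<Sum>j\<in>{1..N} - {i}. b j * K j)"
    by (rule sum.cong) auto
  then show ?thesis
    using assms
    by (simp add: closed_loop_def sum.remove[of "{1..N}" i] del: One_nat_def sum.cl_ivl_Suc)
qed

section \<open>Estimates for square roots and limits\<close>

text \<open>Rationalising gives \<open>1 / (sqrt (u + 1) + sqrt u)\<close>, whose denominator grows
  with \<open>u\<close>.\<close>

lemma sqrt_Suc_diff_antimono:
  fixes s t :: real
  assumes "0 \<le> s" "s \<le> t"
  shows "sqrt (t + 1) - sqrt t \<le> sqrt (s + 1) - sqrt s"
proof -
  have eq: "sqrt (u + 1) - sqrt u = 1 / (sqrt (u + 1) + sqrt u)" if "u \<ge> 0" for u :: real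
  proof -
    have "(sqrt (u + 1) - sqrt u) * (sqrt (u + 1) + sqrt u) = 1"
      using that by (simp add: algebra_simps)
    moreover have "sqrt (u + 1) + sqrt u > 0" using that by (simp add: add_pos_nonneg)
    ultimately show ?thesis by (simp add: eq_divide_eq)
  qed
  have "1 / (sqrt (t + 1) + sqrt t) \<le> 1 / (sqrt (s + 1) + sqrt s)"
    using assms by (intro divide_left_mono add_mono mult_pos_pos add_pos_nonneg) auto
  with assms eq show ?thesis by auto
qed

text \<open>Subadditivity of \<open>sqrt\<close>, applied to \<open>(x\<^sup>2 - s) + s\<close> for
  \<open>s \<ge> 0\<close> and to \<open>x\<^sup>2 + (- s)\<close> for \<open>s < 0\<close>.\<close>

lemma abs_diff_sqrt_le:
  fixes x s :: real
  assumes "0 \<le> x" "s \<le> x\<^sup>2"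
  shows "\<bar>x - sqrt (x\<^sup>2 - s)\<bar> \<le> sqrt \<bar>s\<bar>"
proof (cases "s \<ge> 0")
  case True
  have "x \<le> sqrt (x\<^sup>2 - s) + sqrt s"
    using sqrt_add_le_add_sqrt[of "x\<^sup>2 - s" s] assms True by simp
  moreover have "sqrt (x\<^sup>2 - s) \<le> x"
    using assms True by (intro real_le_lsqrt) auto
  ultimately show ?thesis using True by simp
next
  case False
  have "sqrt (x\<^sup>2 - s) \<le> x + sqrt (- s)"
    using sqrt_add_le_add_sqrt[of "x\<^sup>2" "- s"] assms False by simp
  moreover have "x \<le> sqrt (x\<^sup>2 - s)"
    using assms False by (intro real_le_rsqrt) auto
  ultimately show ?thesis using False by simp
qed

text \<open>Eventually \<open>f\<close> lies below \<open>f (x + 1)\<close>, so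
  \<open>0 \<le> f (x + 1)\<close> in the limit; the strict step back to \<open>x\<close> gives
  positivity.\<close>

lemma strict_decreasing_tendsto_0_pos:
  fixes f :: "real \<Rightarrow> real"
  assumes anti: "\<And>x y. u \<le> x \<Longrightarrow> x < y \<Longrightarrow> f y < f x"
    and lim: "(f \<longlongrightarrow> 0) at_top" and "u \<le> x"
  shows "f x > 0"
proof -
  have "\<forall>\<^sub>F y in at_top. f y \<le> f (x + 1)"
    using eventually_gt_at_top[of "x + 1"]
    by eventually_elim (use anti[of "x + 1"] \<open>u \<le> x\<close> in \<open>simp add: less_imp_le\<close>)
  then have "0 \<le> f (x + 1)"
    using lim by (intro tendsto_upperbound) auto
  also have "\<dots> < f x" using anti \<open>u \<le> x\<close> by simp
  finally show ?thesis .
qed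

section \<open>Change of variable for the closed loop, and the branches\<close>

text \<open>The roots of \<open>c\<^sup>2 + 2 * x * c - 1 = 0\<close> have product -1; the given
  \<open>c\<close> is the root of modulus below 1.\<close>

lemma loop_equation:
  fixes x :: real
  assumes "x \<noteq> 0"
  defines "c \<equiv> sgn x * (sqrt (x\<^sup>2 + 1) - \<bar>x\<bar>)"
  shows "1 - c\<^sup>2 = 2 * c * x" "c \<noteq> 0" "\<bar>c\<bar> < 1"
proof -
  let ?s = "sqrt (x\<^sup>2 + 1)"
  have s: "?s\<^sup>2 = x\<^sup>2 + 1" by (simp add: add_nonneg_nonneg)
  have lt: "\<bar>x\<bar> < ?s" by (rule real_less_rsqrt) simp
  have "?s < sqrt ((\<bar>x\<bar> + 1)\<^sup>2)"
    using assms(1) by (subst real_sqrt_less_iff) (simp add: power2_sum)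
  then have "?s < \<bar>x\<bar> + 1" by simp
  with lt show "c \<noteq> 0" "\<bar>c\<bar> < 1"
    using assms(1) by (auto simp: c_def abs_mult sgn_real_def)
  have sg: "(sgn x)\<^sup>2 = 1" "sgn x * x = \<bar>x\<bar>"
    using assms(1) by (auto simp: sgn_real_def)
  have "1 - c\<^sup>2 = 1 - (?s - \<bar>x\<bar>)\<^sup>2"
    by (simp add: c_def power_mult_distrib sg)
  also have "\<dots> = 2 * (?s - \<bar>x\<bar>) * \<bar>x\<bar>"
    using s power2_abs[of x] by algebra
  also have "\<dots> = 2 * c * x"
    using sg(2) by (simp add: c_def mult.assoc mult.left_commute)
  finally show "1 - c\<^sup>2 = 2 * c * x" .
qed

text \<open>Inverts the previous map: \<open>x\<^sup>2 + 1\<close> is the square of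
  \<open>(1 + c\<^sup>2) / (2 * c)\<close>, so its root is explicit, and \<open>x\<close> has the
  sign of \<open>c\<close>.\<close>

lemma loop_from_ratio:
  fixes c :: real
  assumes "c \<noteq> 0" "\<bar>c\<bar> < 1"
  defines "x \<equiv> (1 - c\<^sup>2) / (2 * c)"
  shows "c = sgn x * (sqrt (x\<^sup>2 + 1) - \<bar>x\<bar>)" "x \<noteq> 0"
proof -
  have pos: "1 - c\<^sup>2 > 0" using assms(2) by (simp add: abs_square_less_1)
  then show "x \<noteq> 0" using assms(1) by (simp add: x_def)
  have sg: "sgn x = sgn c" using pos by (simp add: x_def sgn_divide sgn_mult)
  have "x\<^sup>2 + 1 = ((1 + c\<^sup>2) / (2 * c))\<^sup>2"
    using assms(1) by (simp add: x_def field_simps) algebra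
  then have "sqrt (x\<^sup>2 + 1) = \<bar>(1 + c\<^sup>2) / (2 * c)\<bar>" by simp
  also have "\<dots> = (1 + c\<^sup>2) / (2 * \<bar>c\<bar>)" by (simp add: abs_mult abs_divide add_nonneg_nonneg)
  finally have "sqrt (x\<^sup>2 + 1) - \<bar>x\<bar> = (1 + c\<^sup>2) / (2 * \<bar>c\<bar>) - (1 - c\<^sup>2) / (2 * \<bar>c\<bar>)"
    using pos by (simp add: x_def abs_mult abs_divide)
  also have "\<dots> = \<bar>c\<bar>"
    using assms(1) by (simp add: divide_simps) (simp add: power2_eq_square flip: abs_mult)
  finally show "c = sgn x * (sqrt (x\<^sup>2 + 1) - \<bar>x\<bar>)"
    by (simp add: sg sgn_mult_abs)
qed

text \<open>
  With \<open>\<xi> = (1 - c\<^sup>2) / (2 c)\<close> for the closed loop \<open>c\<close>, the value of \<open>a\<close> at an equilibrium with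
  \<open>\<xi> > 0\<close> is \<open>branch N \<sigma> S \<xi>\<close>, where \<open>S\<close> is the set of players choosing the negative root.
\<close>

definition branch :: "nat \<Rightarrow> (nat \<Rightarrow> real) \<Rightarrow> nat set \<Rightarrow> real \<Rightarrow> real" where
  "branch N \<sigma> S x = (sqrt (x\<^sup>2 + 1) - x) +
     (\<Sum>i=1..N. x - (if i \<in> S then - 1 else 1) * sqrt (x\<^sup>2 - \<sigma> i))"

text \<open>The derivative of \<open>branch N \<sigma> S\<close>, as \<open>DERIV_branch\<close>
  confirms for positive \<open>x\<close> with positive radicands.\<close>

definition slope :: "nat \<Rightarrow> (nat \<Rightarrow> real) \<Rightarrow> nat set \<Rightarrow> real \<Rightarrow> real" where
  "slope N \<sigma> S x = (x / sqrt (x\<^sup>2 + 1) - 1) +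
     (\<Sum>i=1..N. 1 - (if i \<in> S then - 1 else 1) * (x / sqrt (x\<^sup>2 - \<sigma> i)))"

text \<open>
  As \<open>sqrt\<close> is odd and continuous on all of \<open>\<real>\<close>, no restriction to \<open>\<sigma> i \<le> x\<^sup>2\<close> is needed here.
\<close>

lemma continuous_on_branch: "continuous_on A (branch N \<sigma> S)"
  unfolding branch_def by (intro continuous_intros)

text \<open>Flipping the sign of a root changes its summand by twice the root. This compares every
  branch with that of the empty set.\<close>

lemma branch_eq:
  assumes "S \<subseteq> {1..N}"
  shows "branch N \<sigma> S x = branch N \<sigma> {} x + 2 * (\<Sum>i\<in>S. sqrt (x\<^sup>2 - \<sigma> i))"
proof -
  have "(\<Sum>i=1..N. x - (if i \<in> S then - 1 else 1) * sqrt (x\<^sup>2 - \<sigma> i)) =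
      (\<Sum>i=1..N. (x - sqrt (x\<^sup>2 - \<sigma> i)) + (if i \<in> S then 2 * sqrt (x\<^sup>2 - \<sigma> i) else 0))"
    by (rule sum.cong) auto
  also have "\<dots> = (\<Sum>i=1..N. x - sqrt (x\<^sup>2 - \<sigma> i)) + (\<Sum>i\<in>S. 2 * sqrt (x\<^sup>2 - \<sigma> i))"
    using assms by (simp add: sum.distrib sum.If_cases Int_absorb1)
  finally show ?thesis by (simp add: branch_def sum_distrib_left)
qed

lemma DERIV_branch:
  assumes "x > 0" and dom: "\<And>i. i \<in> {1..N} \<Longrightarrow> \<sigma> i < x\<^sup>2"
  shows "(branch N \<sigma> S has_real_derivative slope N \<sigma> S x) (at x)"
proof -
  have *: "((\<lambda>x. sqrt (x\<^sup>2 - s)) has_real_derivative x / sqrt (x\<^sup>2 - s)) (at x)"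
    if "s < x\<^sup>2" for s
    using that by (auto intro!: derivative_eq_intros simp: field_simps)
  have "- 1 < x\<^sup>2" by (rule less_le_trans[of _ 0]) auto
  \<comment> \<open>The case \<open>s = - 1\<close> handles
    \<open>sqrt (x\<^sup>2 + 1)\<close>.\<close>
  note *[of "- 1", OF this, simplified]
  moreover have "((\<lambda>x. \<Sum>i=1..N. x - (if i \<in> S then - 1 else 1) * sqrt (x\<^sup>2 - \<sigma> i))
      has_real_derivative
      (\<Sum>i=1..N. 1 - (if i \<in> S then - 1 else 1) * (x / sqrt (x\<^sup>2 - \<sigma> i)))) (at x)"
    by (intro DERIV_sum DERIV_diff DERIV_ident DERIV_cmult *) (use dom in auto)
  ultimately show ?thesis
    unfolding branch_def slope_def by (intro DERIV_add DERIV_diff DERIV_ident)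
qed

lemma branch_empty_tendsto_0: "(branch N \<sigma> {} \<longlongrightarrow> 0) at_top"
proof -
  have "((\<lambda>x. x - sqrt (x\<^sup>2 - s)) \<longlongrightarrow> 0) at_top" for s :: real
    by real_asymp
  then have "((\<lambda>x. \<Sum>i=1..N. x - sqrt (x\<^sup>2 - \<sigma> i)) \<longlongrightarrow> (\<Sum>i=1..N. 0)) at_top"
    by (intro tendsto_sum)
  moreover have "((\<lambda>x::real. sqrt (x\<^sup>2 + 1) - x) \<longlongrightarrow> 0) at_top"
    by real_asymp
  ultimately have "((\<lambda>x. (sqrt (x\<^sup>2 + 1) - x) + (\<Sum>i=1..N. x - sqrt (x\<^sup>2 - \<sigma> i)))
      \<longlongrightarrow> 0 + (\<Sum>i=1..N. 0)) at_top"
    by (intro tendsto_add)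
  then show ?thesis by (simp add: branch_def[abs_def])
qed

text \<open>Each quotient tends to 1, so a player in \<open>S\<close> contributes 2 and all other
  terms vanish. Branches of nonempty \<open>S\<close> are therefore eventually increasing.\<close>

lemma slope_tendsto:
  assumes "S \<subseteq> {1..N}"
  shows "(slope N \<sigma> S \<longlongrightarrow> 2 * real (card S)) at_top"
proof -
  have "((\<lambda>x. 1 - (if i \<in> S then - 1 else 1) * (x / sqrt (x\<^sup>2 - \<sigma> i))) \<longlongrightarrow>
      (if i \<in> S then 2 else 0)) at_top" for i
    by (cases "i \<in> S"; simp) real_asymp+
  then have "((\<lambda>x. \<Sum>i=1..N. 1 - (if i \<in> S then - 1 else 1) * (x / sqrt (x\<^sup>2 - \<sigma> i))) \<longlongrightarrow>
      (\<Sum>i=1..N. if i \<in> S then 2 else 0)) at_top"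
    by (intro tendsto_sum)
  moreover have "((\<lambda>x::real. x / sqrt (x\<^sup>2 + 1) - 1) \<longlongrightarrow> 0) at_top"
    by real_asymp
  ultimately have "(slope N \<sigma> S \<longlongrightarrow> 0 + (\<Sum>i=1..N. if i \<in> S then 2 else 0)) at_top"
    unfolding slope_def by (intro tendsto_add)
  then show ?thesis
    using assms by (simp add: sum.If_cases Int_absorb1 mult.commute)
qed

section \<open>Equilibria as pairs of a ratio and a set of players\<close>

text \<open>Thanks to the factor \<open>sgn x\<close>, reversing the sign of \<open>x\<close> with
  \<open>S\<close> fixed reverses all gains. This is the symmetry between \<open>a\<close> and
  \<open>-a\<close>, and it lets \<open>pars\<close> evaluate \<open>branch\<close> at
  \<open>\<bar>x\<bar>\<close> only.\<close>

definition profile ::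
  "nat \<Rightarrow> (nat \<Rightarrow> real) \<Rightarrow> (nat \<Rightarrow> real) \<Rightarrow> real \<times> nat set \<Rightarrow> nat \<Rightarrow> real"
where
  "profile N b \<sigma> = (\<lambda>(x, S). \<lambda>i\<in>{1..N}.
     (sgn x * ((if i \<in> S then - 1 else 1) * sqrt (x\<^sup>2 - \<sigma> i)) - x) / b i)"

text \<open>
  The strict inequality for \<open>i \<in> S\<close> makes the parametrisation injective: where the two roots
  coincide, only the choice \<open>i \<notin> S\<close> is allowed.
\<close>

definition pars :: "nat \<Rightarrow> (nat \<Rightarrow> real) \<Rightarrow> real \<Rightarrow> (real \<times> nat set) set" where
  "pars N \<sigma> a = {(x, S). x \<noteq> 0 \<and> S \<subseteq> {1..N} \<and> (\<forall>i\<in>{1..N}. \<sigma> i \<le> x\<^sup>2) \<and>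
     (\<forall>i\<in>S. \<sigma> i < x\<^sup>2) \<and> branch N \<sigma> S \<bar>x\<bar> = sgn x * a}"

locale scalar_lq_game =
  fixes N :: nat and b q r \<sigma> :: "nat \<Rightarrow> real"
  assumes N: "N \<ge> 1"
    and b: "\<And>i. i \<in> {1..N} \<Longrightarrow> b i \<noteq> 0"
    and r: "\<And>i. i \<in> {1..N} \<Longrightarrow> r i > 0"
    and \<sigma>: "\<And>i. i \<in> {1..N} \<Longrightarrow> \<sigma> i = (b i)\<^sup>2 * q i / r i"
    and \<sigma>_le: "\<And>i. i \<in> {1..N} \<Longrightarrow> \<sigma> i \<le> \<sigma> 1"
    and \<sigma>_gt: "\<And>i. i \<in> {1..N} \<Longrightarrow> \<sigma> i > - 1"
begin

text \<open>Up to the factor \<open>r i / (b i)\<^sup>2 * x0\<^sup>2\<close>, the cost is the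
  quotient of \<open>minimiser_iff\<close> at the closed loop, and as \<open>b i \<noteq> 0\<close>
  every closed loop \<open>d\<close> is reached by some deviation.\<close>

lemma best_response_iff:
  assumes i: "i \<in> {1..N}" and adm: "admissible N a b K"
  defines "c \<equiv> closed_loop N a b K" and "\<kappa> \<equiv> b i * K i"
  shows "(\<forall>k'. admissible N a b (K(i := k')) \<longrightarrow>
      (\<forall>x0. fb_cost N a b q r i K x0 \<le> fb_cost N a b q r i (K(i := k')) x0)) \<longleftrightarrow>
    c * \<kappa>\<^sup>2 + (1 - c\<^sup>2) * \<kappa> + c * \<sigma> i = 0"
proof -
  define \<alpha> where "\<alpha> = c - \<kappa>"
  have c: "\<bar>c\<bar> < 1" using adm by (simp add: admissible_def c_def)
  have cl: "closed_loop N a b (K(i := k)) = \<alpha> + b i * k" for k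
    by (simp add: closed_loop_upd[OF i] \<alpha>_def c_def \<kappa>_def)
  let ?\<phi> = "\<lambda>d. (\<sigma> i + (d - \<alpha>)\<^sup>2) / (1 - d\<^sup>2)"
  have bk: "(b i)\<^sup>2 / r i > 0" using b[OF i] r[OF i] by simp
  have cost: "fb_cost N a b q r i (K(i := k)) x0 =
      ?\<phi> (\<alpha> + b i * k) / ((b i)\<^sup>2 / r i) * x0\<^sup>2" if "\<bar>\<alpha> + b i * k\<bar> < 1" for k x0
  proof -
    have "q i + r i * k\<^sup>2 = (\<sigma> i + (b i * k)\<^sup>2) / ((b i)\<^sup>2 / r i)"
      using b[OF i] r[OF i] by (simp add: \<sigma>[OF i] field_simps power_mult_distrib)
    then show ?thesis
      using that by (simp add: fb_cost_admissible admissible_def cl)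
  qed
  have le_iff: "(\<forall>x0. fb_cost N a b q r i K x0 \<le> fb_cost N a b q r i (K(i := k)) x0) \<longleftrightarrow>
      ?\<phi> c \<le> ?\<phi> (\<alpha> + b i * k)" if "\<bar>\<alpha> + b i * k\<bar> < 1" for k
  proof -
    have "fb_cost N a b q r i K x0 = ?\<phi> c / ((b i)\<^sup>2 / r i) * x0\<^sup>2" for x0
      using cost[of "K i"] c by (simp add: \<alpha>_def \<kappa>_def)
    then have "(\<forall>x0. fb_cost N a b q r i K x0 \<le> fb_cost N a b q r i (K(i := k)) x0) \<longleftrightarrow>
        (\<forall>x0. ?\<phi> c / ((b i)\<^sup>2 / r i) * x0\<^sup>2 \<le> ?\<phi> (\<alpha> + b i * k) / ((b i)\<^sup>2 / r i) * x0\<^sup>2)"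
      by (simp only: cost[OF that])
    \<comment> \<open>The instance \<open>x0 = 1\<close> gives the forward direction.\<close>
    also have "\<dots> \<longleftrightarrow> ?\<phi> c / ((b i)\<^sup>2 / r i) \<le> ?\<phi> (\<alpha> + b i * k) / ((b i)\<^sup>2 / r i)"
      by (metis mult.right_neutral mult_right_mono one_power2 zero_le_power2)
    also have "\<dots> \<longleftrightarrow> ?\<phi> c \<le> ?\<phi> (\<alpha> + b i * k)"
      using bk by (subst divide_le_cancel) (meson less_asym)
    finally show ?thesis .
  qed
  have "(\<forall>k'. admissible N a b (K(i := k')) \<longrightarrow>
      (\<forall>x0. fb_cost N a b q r i K x0 \<le> fb_cost N a b q r i (K(i := k')) x0)) \<longleftrightarrow>
    (\<forall>k. \<bar>\<alpha> + b i * k\<bar> < 1 \<longrightarrow> ?\<phi> c \<le> ?\<phi> (\<alpha> + b i * k))"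
    using le_iff by (simp add: admissible_def cl)
  also have "\<dots> \<longleftrightarrow> (\<forall>d. \<bar>d\<bar> < 1 \<longrightarrow> ?\<phi> c \<le> ?\<phi> d)"
  proof -
    have "\<alpha> + b i * ((d - \<alpha>) / b i) = d" for d using b[OF i] by simp
    then show ?thesis by metis
  qed
  also have "\<dots> \<longleftrightarrow> c * \<kappa>\<^sup>2 + (1 - c\<^sup>2) * \<kappa> + c * \<sigma> i = 0"
    using minimiser_iff[OF \<sigma>_gt[OF i] c, of \<alpha>] by (simp add: \<alpha>_def)
  finally show ?thesis .
qed

lemma is_FNE_iff:
  fixes a
  defines "c K \<equiv> closed_loop N a b K"
  shows "is_FNE N a b q r K \<longleftrightarrow> \<bar>c K\<bar> < 1 \<and>
    (\<forall>i\<in>{1..N}. c K * (b i * K i)\<^sup>2 + (1 - (c K)\<^sup>2) * (b i * K i) + c K * \<sigma> i = 0)"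
  using best_response_iff[of _ a K]
  by (auto simp: is_FNE_def c_def admissible_def[of N a b K])

text \<open>Treats the closed loop 0, where the ratio is undefined: the stationarity equations
  collapse to \<open>b i * K i = 0\<close>.\<close>

lemma FNE_closed_loop_0_iff:
  "K \<in> FNE N a b q r \<and> closed_loop N a b K = 0 \<longleftrightarrow> a = 0 \<and> K = (\<lambda>i\<in>{1..N}. 0)"
proof
  assume K: "K \<in> FNE N a b q r \<and> closed_loop N a b K = 0"
  then have ext: "K \<in> {1..N} \<rightarrow>\<^sub>E UNIV" and "\<forall>i\<in>{1..N}. b i * K i = 0"
    by (auto simp: FNE_def is_FNE_iff)
  then have K0: "K i = 0" if "i \<in> {1..N}" for i
    using b that by (metis mult_eq_0_iff)
  then have "K = (\<lambda>i\<in>{1..N}. 0)"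
    using ext by (intro extensionalityI[of _ "{1..N}"]) (auto simp: PiE_def)
  with K K0 show "a = 0 \<and> K = (\<lambda>i\<in>{1..N}. 0)"
    by (simp add: closed_loop_def)
next
  assume "a = 0 \<and> K = (\<lambda>i\<in>{1..N}. 0)"
  then show "K \<in> FNE N a b q r \<and> closed_loop N a b K = 0"
    by (auto simp: FNE_def is_FNE_iff closed_loop_def)
qed

lemma profile_apply:
  assumes "i \<in> {1..N}"
  shows "b i * profile N b \<sigma> (x, S) i =
    sgn x * ((if i \<in> S then - 1 else 1) * sqrt (x\<^sup>2 - \<sigma> i)) - x"
  using assms b[OF assms] by (simp add: profile_def del: atLeastAtMost_iff)

text \<open>The equation for \<open>branch\<close> expresses \<open>a\<close> through the roots
  occurring in the gains; they cancel in the loop and leave the first summand of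
  \<open>branch\<close>.\<close>

lemma closed_loop_profile:
  assumes "x \<noteq> 0" "branch N \<sigma> S \<bar>x\<bar> = sgn x * a"
  shows "closed_loop N a b (profile N b \<sigma> (x, S)) = sgn x * (sqrt (x\<^sup>2 + 1) - \<bar>x\<bar>)"
proof -
  let ?e = "\<lambda>i. if i \<in> S then - 1 else (1::real)"
  have "sgn x * (sgn x * a) = a"
    using assms(1) by (simp add: sgn_real_def)
  then have "closed_loop N a b (profile N b \<sigma> (x, S)) =
      sgn x * branch N \<sigma> S \<bar>x\<bar> +
      (\<Sum>i=1..N. sgn x * (?e i * sqrt (x\<^sup>2 - \<sigma> i)) - x)"
    unfolding closed_loop_def assms(2) by (simp only: profile_apply cong: sum.cong)
  also have "(\<Sum>i=1..N. sgn x * (?e i * sqrt (x\<^sup>2 - \<sigma> i)) - x) =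
      sgn x * (\<Sum>i=1..N. - (\<bar>x\<bar> - ?e i * sqrt (x\<^sup>2 - \<sigma> i)))"
    unfolding sum_distrib_left by (rule sum.cong) (use assms(1) in \<open>auto simp: algebra_simps sgn_real_def\<close>)
  finally show ?thesis
    unfolding branch_def by (simp only: power2_abs sum_negf) (simp add: algebra_simps)
qed

text \<open>Injectivity: the closed loop determines \<open>x\<close>, and then the signs of the
  roots determine \<open>S\<close>. Membership and surjectivity: for
  \<open>1 - c\<^sup>2 = 2 * c * x\<close>, completing the square turns stationarity into
  \<open>(b i * K i + x)\<^sup>2 = x\<^sup>2 - \<sigma> i\<close>.\<close>

lemma bij_betw_profile:
  "bij_betw (profile N b \<sigma>) (pars N \<sigma> a) {K \<in> FNE N a b q r. closed_loop N a b K \<noteq> 0}"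
proof (rule bij_betwI')
  fix p p' assume p: "p \<in> pars N \<sigma> a" and p': "p' \<in> pars N \<sigma> a"
  obtain x S x' S' where eq: "p = (x, S)" "p' = (x', S')" by (cases p; cases p')
  show "profile N b \<sigma> p = profile N b \<sigma> p' \<longleftrightarrow> p = p'"
  proof
    assume pp: "profile N b \<sigma> p = profile N b \<sigma> p'"
    let ?c = "closed_loop N a b (profile N b \<sigma> p)"
    have c: "?c = sgn x * (sqrt (x\<^sup>2 + 1) - \<bar>x\<bar>)" "x \<noteq> 0"
      using p eq by (auto simp: pars_def closed_loop_profile)
    have c': "?c = sgn x' * (sqrt (x'\<^sup>2 + 1) - \<bar>x'\<bar>)" "x' \<noteq> 0"
      using p' eq pp by (auto simp: pars_def closed_loop_profile)
    have "2 * ?c * x = 2 * ?c * x'"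
      using loop_equation(1)[of x, OF c(2), folded c(1)]
        loop_equation(1)[of x', OF c'(2), folded c'(1)] by (rule trans[OF sym])
    then have x: "x = x'"
      using loop_equation(2)[of x, OF c(2), folded c(1)] by simp
    \<comment> \<open>The strict inequality in \<open>pars\<close> makes the root of a player in
      \<open>T\<close> nonzero, so the sign reveals membership.\<close>
    have mem: "i \<in> T \<longleftrightarrow> sgn x * (b i * profile N b \<sigma> (x, T) i + x) < 0"
      if "(x, T) \<in> pars N \<sigma> a" "i \<in> {1..N}" for i T
    proof -
      have dom: "\<sigma> i \<le> x\<^sup>2" and strict: "i \<in> T \<Longrightarrow> \<sigma> i < x\<^sup>2"
        using that by (auto simp: pars_def)
      have "sgn x * (b i * profile N b \<sigma> (x, T) i + x) =
          (if i \<in> T then - 1 else 1) * sqrt (x\<^sup>2 - \<sigma> i)"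
        using \<open>x \<noteq> 0\<close> by (simp add: profile_apply[OF that(2)] sgn_real_def)
      then show ?thesis using dom strict by (auto simp: not_less)
    qed
    have "S \<subseteq> {1..N}" "S' \<subseteq> {1..N}" using p p' eq by (auto simp: pars_def)
    moreover have "i \<in> S \<longleftrightarrow> i \<in> S'" if "i \<in> {1..N}" for i
      using mem[of S i] mem[of S' i] p p' eq x pp that by simp
    ultimately have "S = S'" by blast
    with x eq show "p = p'" by simp
  qed simp
next
  fix p assume p: "p \<in> pars N \<sigma> a"
  obtain x S where eq: "p = (x, S)" by (cases p)
  let ?c = "closed_loop N a b (profile N b \<sigma> p)"
  have x: "x \<noteq> 0" and dom: "\<And>i. i \<in> {1..N} \<Longrightarrow> \<sigma> i \<le> x\<^sup>2"
    and c: "?c = sgn x * (sqrt (x\<^sup>2 + 1) - \<bar>x\<bar>)"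
    using p eq by (auto simp: pars_def closed_loop_profile)
  note loop = loop_equation[OF x, folded c]
  have "?c * (b i * profile N b \<sigma> p i)\<^sup>2 + (1 - ?c\<^sup>2) * (b i * profile N b \<sigma> p i) + ?c * \<sigma> i = 0"
    if i: "i \<in> {1..N}" for i
  proof -
    let ?\<kappa> = "b i * profile N b \<sigma> p i"
    have "(?\<kappa> + x)\<^sup>2 = x\<^sup>2 - \<sigma> i"
      using x dom[OF i] unfolding eq profile_apply[OF i]
      by (simp add: power_mult_distrib sgn_real_def)
    then show ?thesis using loop(1) by algebra
  qed
  moreover have "profile N b \<sigma> p \<in> {1..N} \<rightarrow>\<^sub>E UNIV"
    by (simp add: profile_def eq)
  ultimately show "profile N b \<sigma> p \<in> {K \<in> FNE N a b q r. closed_loop N a b K \<noteq> 0}"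
    using loop by (simp add: FNE_def is_FNE_iff)
next
  fix K assume "K \<in> {K \<in> FNE N a b q r. closed_loop N a b K \<noteq> 0}"
  then have ext: "K \<in> {1..N} \<rightarrow>\<^sub>E UNIV" and fne: "is_FNE N a b q r K"
    and c0: "closed_loop N a b K \<noteq> 0"
    by (auto simp: FNE_def)
  define c where "c = closed_loop N a b K"
  define x where "x = (1 - c\<^sup>2) / (2 * c)"
  \<comment> \<open>These players use the negative root, measured relative to the sign of
    \<open>x\<close>.\<close>
  define S where "S = {i \<in> {1..N}. sgn x * (b i * K i + x) < 0}"
  have c1: "\<bar>c\<bar> < 1" using fne by (simp add: is_FNE_iff c_def)
  have c0: "c \<noteq> 0" using c0 by (simp add: c_def)
  have c: "c = sgn x * (sqrt (x\<^sup>2 + 1) - \<bar>x\<bar>)" and x: "x \<noteq> 0"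
    using loop_from_ratio[OF c0 c1] by (simp_all add: x_def)
  have cx: "1 - c\<^sup>2 = 2 * c * x" using c0 by (simp add: x_def)
  have sq: "(b i * K i + x)\<^sup>2 = x\<^sup>2 - \<sigma> i" if i: "i \<in> {1..N}" for i
  proof -
    have "c * (b i * K i)\<^sup>2 + (1 - c\<^sup>2) * (b i * K i) + c * \<sigma> i = 0"
      using fne i unfolding is_FNE_iff c_def by blast
    then have "c * ((b i * K i + x)\<^sup>2 - (x\<^sup>2 - \<sigma> i)) = 0"
      using cx by algebra
    then show ?thesis using c0 by simp
  qed
  have dom: "\<sigma> i \<le> x\<^sup>2" if i: "i \<in> {1..N}" for i
    using sq[OF i] zero_le_power2[of "b i * K i + x"] by linarith
  have strict: "\<sigma> i < x\<^sup>2" if i: "i \<in> S" for i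
  proof -
    have "b i * K i + x \<noteq> 0" using i by (auto simp: S_def)
    then have "(b i * K i + x)\<^sup>2 > 0" by simp
    moreover have "i \<in> {1..N}" using i by (simp add: S_def)
    ultimately show ?thesis using sq[of i] by linarith
  qed
  have root: "sgn x * ((if i \<in> S then - 1 else 1) * sqrt (x\<^sup>2 - \<sigma> i)) = b i * K i + x"
    if i: "i \<in> {1..N}" for i
  proof -
    have "sqrt (x\<^sup>2 - \<sigma> i) = \<bar>b i * K i + x\<bar>" by (simp flip: sq[OF i])
    moreover have "i \<in> S \<longleftrightarrow> sgn x * (b i * K i + x) < 0" using i by (simp add: S_def)
    moreover have "sgn x = 1 \<or> sgn x = - 1" using x by (simp add: sgn_real_def)
    ultimately show ?thesis by (auto simp: abs_if)
  qed
  have K: "K = profile N b \<sigma> (x, S)"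
  proof (rule extensionalityI[of _ "{1..N}"])
    show "K \<in> extensional {1..N}" "profile N b \<sigma> (x, S) \<in> extensional {1..N}"
      using ext by (auto simp: profile_def PiE_def)
    fix i assume i: "i \<in> {1..N}"
    then have "b i * K i = b i * profile N b \<sigma> (x, S) i"
      by (simp only: profile_apply root)
    then show "K i = profile N b \<sigma> (x, S) i" using b[OF i] by simp
  qed
  have "branch N \<sigma> S \<bar>x\<bar> = sgn x * a"
  proof -
    have "(\<Sum>i=1..N. \<bar>x\<bar> - (if i \<in> S then - 1 else 1) * sqrt (x\<^sup>2 - \<sigma> i)) =
        (\<Sum>i=1..N. - sgn x * (b i * K i))"
    proof (rule sum.cong)
      fix i assume i: "i \<in> {1..N}"
      have "sgn x * (b i * K i + x) = (if i \<in> S then - 1 else 1) * sqrt (x\<^sup>2 - \<sigma> i)"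
        using x by (simp add: sgn_real_def flip: root[OF i])
      then show "\<bar>x\<bar> - (if i \<in> S then - 1 else 1) * sqrt (x\<^sup>2 - \<sigma> i) = - sgn x * (b i * K i)"
        using x by (auto simp: algebra_simps sgn_real_def)
    qed simp
    also have "\<dots> = sgn x * a - sgn x * c"
      by (simp add: c_def closed_loop_def algebra_simps sum_distrib_left sum_negf)
    finally show ?thesis
      using x by (simp add: branch_def c sgn_real_def)
  qed
  with x dom strict have "(x, S) \<in> pars N \<sigma> a"
    by (auto simp: pars_def S_def)
  with K show "\<exists>p\<in>pars N \<sigma> a. K = profile N b \<sigma> p" by blast
qed

lemma bij_betw_profile_nonzero:
  assumes "a \<noteq> 0"
  shows "bij_betw (profile N b \<sigma>) (pars N \<sigma> a) (FNE N a b q r)"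
proof -
  have "{K \<in> FNE N a b q r. closed_loop N a b K \<noteq> 0} = FNE N a b q r"
    using FNE_closed_loop_0_iff assms by blast
  then show ?thesis using bij_betw_profile[of a] by simp
qed

text \<open>For \<open>a = 0\<close> the zero tuple is the one equilibrium outside the
  parametrisation.\<close>

lemma FNE_0:
  assumes "pars N \<sigma> 0 = {}"
  shows "FNE N 0 b q r = {\<lambda>i\<in>{1..N}. 0}"
  using bij_betw_profile[of 0] FNE_closed_loop_0_iff[of _ 0] assms
  by (auto simp: bij_betw_def)

section \<open>The common domain of the branches and their comparison\<close>

text \<open>Left end of the range of \<open>\<bar>x\<bar>\<close> on which all radicands are
  nonnegative; the maximum with 0 covers \<open>\<sigma> 1 \<le> 0\<close>.\<close>

definition edge :: real where "edge = sqrt (max 0 (\<sigma> 1))"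

lemma edge_nonneg: "edge \<ge> 0"
  by (simp add: edge_def)

lemma edge_sq: "edge\<^sup>2 = max 0 (\<sigma> 1)"
  by (simp add: edge_def)

lemma dom_iff:
  assumes "x > 0"
  shows "(\<forall>i\<in>{1..N}. \<sigma> i \<le> x\<^sup>2) \<longleftrightarrow> edge \<le> x"
proof -
  have "(\<forall>i\<in>{1..N}. \<sigma> i \<le> x\<^sup>2) \<longleftrightarrow> \<sigma> 1 \<le> x\<^sup>2"
    using \<sigma>_le N by (meson atLeastAtMost_iff order_refl order_trans)
  also have "\<dots> \<longleftrightarrow> edge\<^sup>2 \<le> x\<^sup>2" by (simp add: edge_sq)
  also have "\<dots> \<longleftrightarrow> edge \<le> x" using edge_nonneg assms by (simp add: power_mono_iff)
  finally show ?thesis .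
qed

lemma \<sigma>_le_sq: "edge \<le> x \<Longrightarrow> i \<in> {1..N} \<Longrightarrow> \<sigma> i \<le> x\<^sup>2"
  using power_mono[of edge x 2] edge_nonneg \<sigma>_le[of i] edge_sq by linarith

lemma \<sigma>_less_sq: "edge < x \<Longrightarrow> i \<in> {1..N} \<Longrightarrow> \<sigma> i < x\<^sup>2"
  using power_strict_mono[of edge x 2] edge_nonneg \<sigma>_le[of i] edge_sq by linarith

lemma pars_iff:
  "(x, S) \<in> pars N \<sigma> a \<longleftrightarrow> x \<noteq> 0 \<and> edge \<le> \<bar>x\<bar> \<and> S \<subseteq> {1..N} \<and> (\<forall>i\<in>S. \<sigma> i < x\<^sup>2) \<and>
     branch N \<sigma> S \<bar>x\<bar> = sgn x * a"
  using dom_iff[of "\<bar>x\<bar>"] by (auto simp: pars_def)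

lemma branch_ge_insert:
  assumes "S \<subseteq> {1..N}" "i \<in> S" "edge \<le> x"
  shows "branch N \<sigma> {} x + 2 * sqrt (x\<^sup>2 - \<sigma> i) \<le> branch N \<sigma> S x"
proof -
  have "finite S" using assms(1) finite_subset by blast
  moreover have "sqrt (x\<^sup>2 - \<sigma> j) \<ge> 0" if "j \<in> S" for j
    using \<sigma>_le_sq[OF assms(3), of j] that assms(1) by auto
  ultimately have "sqrt (x\<^sup>2 - \<sigma> i) \<le> (\<Sum>j\<in>S. sqrt (x\<^sup>2 - \<sigma> j))"
    using assms(2) by (intro member_le_sum) auto
  then show ?thesis by (simp add: branch_eq[OF assms(1)])
qed

lemma branch_ge_empty:
  assumes "S \<subseteq> {1..N}" "edge \<le> x"
  shows "branch N \<sigma> {} x \<le> branch N \<sigma> S x"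
  using \<sigma>_le_sq[OF assms(2)] assms(1) by (auto simp: branch_eq[OF assms(1)] intro!: sum_nonneg)

text \<open>One root of a player in \<open>S\<close> already tends to infinity, while the branch of
  \<open>{}\<close> tends to 0.\<close>

lemma branch_greater:
  assumes S: "S \<subseteq> {1..N}" "S \<noteq> {}" and "edge \<le> x"
  shows "\<exists>y>x. branch N \<sigma> S y > C"
proof -
  obtain i where i: "i \<in> S" using S(2) by blast
  have "filterlim (\<lambda>x::real. 2 * sqrt (x\<^sup>2 - \<sigma> i)) at_top at_top" by real_asymp
  then have "filterlim (\<lambda>x. branch N \<sigma> {} x + 2 * sqrt (x\<^sup>2 - \<sigma> i)) at_top at_top"
    by (rule filterlim_tendsto_add_at_top[OF branch_empty_tendsto_0])
  then have "\<forall>\<^sub>F y in at_top. branch N \<sigma> {} y + 2 * sqrt (y\<^sup>2 - \<sigma> i) > C"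
    by (simp add: filterlim_at_top_dense)
  then have "\<forall>\<^sub>F y in at_top. y > x \<and> branch N \<sigma> S y > C"
    using eventually_gt_at_top[of x]
  proof eventually_elim
    case (elim y)
    then show ?case using branch_ge_insert[OF S(1) i, of y] \<open>edge \<le> x\<close> by linarith
  qed
  then show ?thesis using eventually_happens by fastforce
qed

lemma branch_empty_small:
  assumes "e > 0"
  shows "\<exists>y>x. \<bar>branch N \<sigma> {} y\<bar> < e"
proof -
  have "\<forall>\<^sub>F y in at_top. \<bar>branch N \<sigma> {} y\<bar> < e"
    using tendstoD[OF branch_empty_tendsto_0 assms] by simp
  then have "\<forall>\<^sub>F y in at_top. y > x \<and> \<bar>branch N \<sigma> {} y\<bar> < e"
    using eventually_gt_at_top[of x] by eventually_elim simp
  then show ?thesis using eventually_happens by fastforce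
qed

lemma branch_empty_decreasing:
  assumes "\<And>x. edge < x \<Longrightarrow> e * slope N \<sigma> {} x < 0" "edge \<le> x" "x < y"
  shows "e * branch N \<sigma> {} y < e * branch N \<sigma> {} x"
proof (rule DERIV_neg_imp_decreasing_open[OF \<open>x < y\<close>])
  fix z assume "x < z" "z < y"
  then have "edge < z" using assms by simp
  then have "((\<lambda>x. e * branch N \<sigma> {} x) has_real_derivative e * slope N \<sigma> {} z) (at z)"
    using edge_nonneg by (intro DERIV_cmult DERIV_branch \<sigma>_less_sq) auto
  with assms(1)[OF \<open>edge < z\<close>]
  show "\<exists>d. ((\<lambda>x. e * branch N \<sigma> {} x) has_real_derivative d) (at z) \<and> d < 0" by blast
qed (intro continuous_intros continuous_on_branch)

text \<open>
  The sign \<open>e\<close> covers the case \<open>\<sigma> 1 \<le> 0\<close>, where the branch of \<open>S = {}\<close> may be negative and increasing.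
\<close>

lemma unique_FNE:
  assumes e: "e = 1 \<or> e = - 1"
    and S: "\<And>S x. edge \<le> x \<Longrightarrow> 0 < x \<Longrightarrow> S \<subseteq> {1..N} \<Longrightarrow> S \<noteq> {} \<Longrightarrow>
      (\<And>i. i \<in> S \<Longrightarrow> \<sigma> i < x\<^sup>2) \<Longrightarrow> \<bar>a\<bar> < branch N \<sigma> S x"
    and anti: "\<And>x y. edge \<le> x \<Longrightarrow> x < y \<Longrightarrow> e * branch N \<sigma> {} y < e * branch N \<sigma> {} x"
    and a: "\<bar>a\<bar> < e * branch N \<sigma> {} edge"
  shows "\<exists>!K. K \<in> FNE N a b q r"
proof -
  let ?g = "\<lambda>x. e * branch N \<sigma> {} x"
  have "(?g \<longlongrightarrow> e * 0) at_top"
    by (intro tendsto_intros branch_empty_tendsto_0)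
  then have pos: "?g x > 0" if "edge \<le> x" for x
    using anti that by (intro strict_decreasing_tendsto_0_pos[of edge]) auto
  \<comment> \<open>Every other branch stays above \<open>\<bar>a\<bar>\<close>, so
    \<open>S = {}\<close>; positivity of \<open>?g\<close> then fixes the sign of
    \<open>x\<close>.\<close>
  have pars_dest: "S = {} \<and> edge \<le> \<bar>x\<bar> \<and> ?g \<bar>x\<bar> = \<bar>a\<bar> \<and> a \<noteq> 0 \<and> sgn x = e * sgn a"
    if xS: "(x, S) \<in> pars N \<sigma> a" for x S
  proof -
    have x: "x \<noteq> 0" "edge \<le> \<bar>x\<bar>" "S \<subseteq> {1..N}" "\<And>i. i \<in> S \<Longrightarrow> \<sigma> i < \<bar>x\<bar>\<^sup>2"
      and br: "branch N \<sigma> S \<bar>x\<bar> = sgn x * a"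
      using xS by (auto simp: pars_iff)
    have "sgn x * a \<le> \<bar>a\<bar>" by (auto simp: sgn_real_def)
    then have "S = {}" using S[of "\<bar>x\<bar>" S] x br by fastforce
    moreover have "e * (sgn x * a) > 0"
      using pos[of "\<bar>x\<bar>"] br x \<open>S = {}\<close> by simp
    ultimately show ?thesis
      using x br e by (auto simp: sgn_real_def abs_if zero_less_mult_iff split: if_splits)
  qed
  show ?thesis
  proof (cases "a = 0")
    case True
    then have "pars N \<sigma> 0 = {}" using pars_dest by auto
    then show ?thesis using FNE_0 True by simp
  next
    case False
    obtain z where z: "z > edge" "\<bar>branch N \<sigma> {} z\<bar> < \<bar>a\<bar>"
      using branch_empty_small[of "\<bar>a\<bar>" edge] False by auto
    then have "?g z \<le> \<bar>a\<bar>" using e by auto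
    then obtain x where x: "edge \<le> x" "?g x = \<bar>a\<bar>"
      using IVT2'[of ?g z "\<bar>a\<bar>" edge] a z
      by (fastforce intro: continuous_intros continuous_on_branch)
    \<comment> \<open>Only \<open>x = edge\<close> could be 0, and there \<open>?g\<close> exceeds
      \<open>\<bar>a\<bar>\<close>.\<close>
    have "x > 0" using x a edge_nonneg by (cases "x = edge") auto
    have "pars N \<sigma> a = {(e * sgn a * x, {})}"
    proof (intro equalityI subsetI)
      fix p assume p: "p \<in> pars N \<sigma> a"
      obtain y S where eq: "p = (y, S)" by (cases p)
      have y: "S = {}" "edge \<le> \<bar>y\<bar>" "?g \<bar>y\<bar> = \<bar>a\<bar>" "sgn y = e * sgn a"
        using pars_dest p eq by auto
      then have "\<bar>y\<bar> = x"
        using anti[of x "\<bar>y\<bar>"] anti[of "\<bar>y\<bar>" x] x by (cases "\<bar>y\<bar>" x rule: linorder_cases) auto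
      then have "y = e * sgn a * x"
        using y(4) mult_sgn_abs[of y] by simp
      then show "p \<in> {(e * sgn a * x, {})}" using y(1) eq by simp
    next
      fix p assume "p \<in> {(e * sgn a * x, {} :: nat set)}"
      moreover have "branch N \<sigma> {} x = e * \<bar>a\<bar>" using x(2) e by auto
      ultimately show "p \<in> pars N \<sigma> a"
        using x(1) \<open>x > 0\<close> False e by (auto simp: pars_iff sgn_real_def abs_mult)
    qed
    then have "FNE N a b q r = {profile N b \<sigma> (e * sgn a * x, {})}"
      using bij_betw_profile_nonzero[OF False] by (simp add: bij_betw_def)
    then show ?thesis by simp
  qed
qed

section \<open>Counting the equilibria for large \<open>\<bar>a\<bar>\<close>\<close>

lemma abs_branch_empty_le:
  assumes "edge \<le> x"
  shows "\<bar>branch N \<sigma> {} x\<bar> \<le> 1 + (\<Sum>i=1..N. sqrt \<bar>\<sigma> i\<bar>)"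
proof -
  have x: "x \<ge> 0" using assms edge_nonneg by linarith
  have "\<bar>sqrt (x\<^sup>2 + 1) - x\<bar> \<le> 1"
    using abs_diff_sqrt_le[OF x, of "- 1"] order_trans[of "- 1" 0 "x\<^sup>2"]
    by (simp add: abs_minus_commute)
  moreover have "\<bar>\<Sum>i=1..N. x - sqrt (x\<^sup>2 - \<sigma> i)\<bar> \<le> (\<Sum>i=1..N. sqrt \<bar>\<sigma> i\<bar>)"
    using x \<sigma>_le_sq[OF assms] by (intro sum_abs[THEN order_trans] sum_mono abs_diff_sqrt_le) auto
  ultimately show ?thesis by (simp add: branch_def)
qed

text \<open>Beyond \<open>X\<close> every branch of nonempty \<open>S\<close> increases strictly and
  is unbounded, and up to \<open>X\<close> all branches stay below \<open>A\<close>. So for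
  \<open>\<bar>a\<bar> > A\<close> each nonempty \<open>S\<close> yields exactly one pair, while the
  bounded branch of \<open>{}\<close> yields none.\<close>

lemma card_FNE_large:
  "\<exists>A>0. \<forall>a. \<bar>a\<bar> > A \<longrightarrow> card (FNE N a b q r) = 2 ^ N - 1"
proof -
  have "\<forall>S\<in>Pow {1..N} - {{}}. \<forall>\<^sub>F x in at_top. slope N \<sigma> S x > 0"
  proof
    fix S :: "nat set" assume S: "S \<in> Pow {1..N} - {{}}"
    then have "card S > 0" by (auto simp: card_gt_0_iff intro: finite_subset)
    then show "\<forall>\<^sub>F x in at_top. slope N \<sigma> S x > 0"
      using S by (intro order_tendstoD(1)[OF slope_tendsto]) auto
  qed
  then have "\<forall>\<^sub>F x in at_top. \<forall>S\<in>Pow {1..N} - {{}}. slope N \<sigma> S x > 0"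
    by (intro eventually_ball_finite) auto
  then obtain X0 where X0: "\<And>x S. x \<ge> X0 \<Longrightarrow> S \<in> Pow {1..N} - {{}} \<Longrightarrow> slope N \<sigma> S x > 0"
    unfolding eventually_at_top_linorder by blast
  define X where "X = max X0 (edge + 1)"
  have X: "edge < X" "0 < X" using edge_nonneg by (auto simp: X_def)
  have mono: "branch N \<sigma> S x < branch N \<sigma> S y"
    if "X \<le> x" "x < y" "S \<subseteq> {1..N}" "S \<noteq> {}" for S x y
  proof (rule DERIV_pos_imp_increasing[OF \<open>x < y\<close>])
    fix z assume "x \<le> z" "z \<le> y"
    then have "X0 \<le> z" "edge < z" "0 < z" using that X edge_nonneg by (auto simp: X_def)
    then show "\<exists>d. (branch N \<sigma> S has_real_derivative d) (at z) \<and> d > 0"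
      using DERIV_branch[of z N \<sigma> S] \<sigma>_less_sq X0[of z S] that by blast
  qed
  \<comment> \<open>\<open>B\<close> bounds the branch of \<open>{}\<close> everywhere on its
    domain; \<open>A\<close> bounds all branches up to \<open>X\<close>.\<close>
  define B where "B = 1 + (\<Sum>i=1..N. sqrt \<bar>\<sigma> i\<bar>)"
  define A where "A = B + 2 * (\<Sum>i=1..N. sqrt (X\<^sup>2 + \<bar>\<sigma> i\<bar>))"
  have "B > 0" by (auto simp: B_def intro!: add_pos_nonneg sum_nonneg)
  moreover have "B \<le> A" by (auto simp: A_def intro!: sum_nonneg)
  ultimately have "A > 0" by linarith
  have branch_le: "branch N \<sigma> S x \<le> A" if "edge \<le> x" "x \<le> X" "S \<subseteq> {1..N}" for S x
  proof -
    have "x\<^sup>2 \<le> X\<^sup>2" using that edge_nonneg by (intro power_mono) auto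
    then have le: "x\<^sup>2 - \<sigma> i \<le> X\<^sup>2 + \<bar>\<sigma> i\<bar>" for i
      using abs_ge_minus_self[of "\<sigma> i"] by linarith
    have "(\<Sum>i\<in>S. sqrt (x\<^sup>2 - \<sigma> i)) \<le> (\<Sum>i\<in>S. sqrt (X\<^sup>2 + \<bar>\<sigma> i\<bar>))"
      by (intro sum_mono real_sqrt_le_mono le)
    also have "\<dots> \<le> (\<Sum>i=1..N. sqrt (X\<^sup>2 + \<bar>\<sigma> i\<bar>))"
      using that(3) by (intro sum_mono2) auto
    finally show ?thesis
      using abs_branch_empty_le[OF that(1)] by (simp add: branch_eq[OF that(3)] A_def B_def)
  qed
  have "card (FNE N a b q r) = 2 ^ N - 1" if a: "\<bar>a\<bar> > A" for a
  proof -
    have "a \<noteq> 0" using a \<open>A > 0\<close> by auto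
    have pars_dest: "S \<noteq> {} \<and> S \<subseteq> {1..N} \<and> X < \<bar>x\<bar> \<and> branch N \<sigma> S \<bar>x\<bar> = \<bar>a\<bar> \<and> sgn x = sgn a"
      if xS: "(x, S) \<in> pars N \<sigma> a" for x S
    proof -
      have x: "x \<noteq> 0" "edge \<le> \<bar>x\<bar>" "S \<subseteq> {1..N}" and br: "branch N \<sigma> S \<bar>x\<bar> = sgn x * a"
        using xS by (auto simp: pars_iff)
      have B: "\<bar>branch N \<sigma> {} \<bar>x\<bar>\<bar> < \<bar>a\<bar>"
        using abs_branch_empty_le[OF x(2)] \<open>B \<le> A\<close> a by (simp add: B_def)
      \<comment> \<open>No branch reaches down to \<open>- \<bar>a\<bar>\<close>, so
        \<open>x\<close> must have the sign of \<open>a\<close>.\<close>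
      then have "sgn x * a > - \<bar>a\<bar>"
        using branch_ge_empty[OF x(3,2)] br by linarith
      then have sgn: "sgn x = sgn a" using x(1) by (auto simp: sgn_real_def split: if_splits)
      then have br': "branch N \<sigma> S \<bar>x\<bar> = \<bar>a\<bar>" using br by (simp add: sgn_mult_self_eq abs_sgn mult.commute)
      moreover have "S \<noteq> {}" using br' B by auto
      moreover have "X < \<bar>x\<bar>" using branch_le[of "\<bar>x\<bar>" S] x br' a by force
      ultimately show ?thesis using x(3) sgn by blast
    qed
    have "bij_betw snd (pars N \<sigma> a) (Pow {1..N} - {{}})"
    proof (rule bij_betwI')
      fix p p' assume p: "p \<in> pars N \<sigma> a" and p': "p' \<in> pars N \<sigma> a"
      obtain x S x' S' where eq: "p = (x, S)" "p' = (x', S')" by (cases p; cases p')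
      have "x = x'" if "S = S'"
      proof -
        have d: "S \<noteq> {}" "S \<subseteq> {1..N}" "X < \<bar>x\<bar>" "branch N \<sigma> S \<bar>x\<bar> = \<bar>a\<bar>" "sgn x = sgn a"
          "X < \<bar>x'\<bar>" "branch N \<sigma> S \<bar>x'\<bar> = \<bar>a\<bar>" "sgn x' = sgn a"
          using pars_dest[of x S] pars_dest[of x' S'] p p' eq that by auto
        then have "\<bar>x\<bar> = \<bar>x'\<bar>"
          using mono[of "\<bar>x\<bar>" "\<bar>x'\<bar>" S] mono[of "\<bar>x'\<bar>" "\<bar>x\<bar>" S]
          by (cases "\<bar>x\<bar>" "\<bar>x'\<bar>" rule: linorder_cases) auto
        then show "x = x'" using d by (metis sgn_mult_abs)
      qed
      then show "snd p = snd p' \<longleftrightarrow> p = p'" using eq by auto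
    next
      fix p assume "p \<in> pars N \<sigma> a"
      then show "snd p \<in> Pow {1..N} - {{}}" using pars_dest by (cases p) auto
    next
      fix S assume S: "S \<in> Pow {1..N} - {{}}"
      obtain z where z: "z > X" "branch N \<sigma> S z > \<bar>a\<bar>"
        using branch_greater[of S X "\<bar>a\<bar>"] S X by auto
      have "branch N \<sigma> S X \<le> \<bar>a\<bar>" using branch_le[of X S] S X a by auto
      then obtain x where x: "X \<le> x" "branch N \<sigma> S x = \<bar>a\<bar>"
        using IVT'[of "branch N \<sigma> S" X "\<bar>a\<bar>" z] z continuous_on_branch by fastforce
      then have "(sgn a * x, S) \<in> pars N \<sigma> a"
        using S X \<open>a \<noteq> 0\<close> \<sigma>_less_sq[of x] by (auto simp: pars_iff sgn_real_def)
      then show "\<exists>p\<in>pars N \<sigma> a. S = snd p" by force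
    qed
    then have "card (pars N \<sigma> a) = card (Pow {1..N} - {{}})"
      by (rule bij_betw_same_card)
    then have "card (pars N \<sigma> a) = 2 ^ N - 1"
      by (simp add: card_Diff_subset card_Pow)
    then show ?thesis
      using bij_betw_same_card[OF bij_betw_profile_nonzero[OF \<open>a \<noteq> 0\<close>]] by simp
  qed
  with \<open>A > 0\<close> show ?thesis by blast
qed

text \<open>
  The branches of \<open>{}\<close> and \<open>{1}\<close> meet at \<open>edge\<close>, so together they cover every positive height.
\<close>

lemma FNE_nonempty:
  assumes "\<sigma> 1 > 0"
  shows "FNE N a b q r \<noteq> {}"
proof (cases "a = 0")
  case True
  then show ?thesis using FNE_closed_loop_0_iff[of _ a] by auto
next
  case False
  have edge: "edge > 0" "edge\<^sup>2 = \<sigma> 1" using assms by (auto simp: edge_def)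
  obtain S x where S: "S \<subseteq> {1..N}" and x: "edge \<le> x" "branch N \<sigma> S x = \<bar>a\<bar>"
  proof (cases "\<bar>a\<bar> \<le> branch N \<sigma> {} edge")
    case True
    obtain z where z: "z > edge" "\<bar>branch N \<sigma> {} z\<bar> < \<bar>a\<bar>"
      using branch_empty_small[of "\<bar>a\<bar>" edge] False by auto
    then obtain x where "edge \<le> x" "branch N \<sigma> {} x = \<bar>a\<bar>"
      using IVT2'[of "branch N \<sigma> {}" z "\<bar>a\<bar>" edge] True continuous_on_branch by fastforce
    then show ?thesis by (intro that[of "{}" x]) auto
  next
    case False
    have S: "{1} \<subseteq> {1..N}" using N by auto
    have "branch N \<sigma> {1} edge \<le> \<bar>a\<bar>"
      using False by (subst branch_eq[OF S]) (simp add: edge(2))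
    moreover obtain z where "z > edge" "branch N \<sigma> {1} z > \<bar>a\<bar>"
      using branch_greater[of "{1}" edge "\<bar>a\<bar>"] S by auto
    ultimately obtain x where "edge \<le> x" "branch N \<sigma> {1} x = \<bar>a\<bar>"
      using IVT'[of "branch N \<sigma> {1}" edge "\<bar>a\<bar>" z] continuous_on_branch by fastforce
    then show ?thesis using S that by blast
  qed
  \<comment> \<open>Players with a vanishing root are dropped to meet the strict inequality in
    \<open>pars\<close>; the value of the branch is unchanged.\<close>
  define S' where "S' = {i \<in> S. \<sigma> i < x\<^sup>2}"
  have S': "S' \<subseteq> {1..N}" using S by (auto simp: S'_def)
  have "(\<Sum>i\<in>S'. sqrt (x\<^sup>2 - \<sigma> i)) = (\<Sum>i\<in>S. sqrt (x\<^sup>2 - \<sigma> i))"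
  proof (rule sum.mono_neutral_left)
    show "finite S" using S finite_subset by blast
    show "\<forall>i\<in>S - S'. sqrt (x\<^sup>2 - \<sigma> i) = 0"
      using S \<sigma>_le_sq[OF x(1)] by (force simp: S'_def)
  qed (auto simp: S'_def)
  then have "branch N \<sigma> S' x = \<bar>a\<bar>"
    using x(2) by (simp add: branch_eq[OF S] branch_eq[OF S'])
  then have "(sgn a * x, S') \<in> pars N \<sigma> a"
    using S' x(1) edge(1) False by (auto simp: pars_iff sgn_real_def S'_def)
  then show ?thesis
    using bij_betw_profile_nonzero[OF False] by (auto simp: bij_betw_def)
qed

section \<open>The closed-loop bound and the uniqueness results\<close>

text \<open>The modulus of a nonzero closed loop is
  \<open>sqrt (x\<^sup>2 + 1) - \<bar>x\<bar>\<close>, which decreases in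
  \<open>\<bar>x\<bar>\<close>, and \<open>x\<^sup>2 \<ge> \<sigma> 1 \<ge> s\<close>.\<close>

lemma abs_closed_loop_le:
  assumes "\<sigma> 1 > 0" "0 \<le> s" "s \<le> \<sigma> 1" and K: "K \<in> FNE N a b q r"
  shows "\<bar>closed_loop N a b K\<bar> \<le> \<bar>sqrt s - sqrt (s + 1)\<bar>"
proof (cases "closed_loop N a b K = 0")
  case False
  then obtain x S where xS: "(x, S) \<in> pars N \<sigma> a" "K = profile N b \<sigma> (x, S)"
    using K bij_betw_profile[of a] by (force simp: bij_betw_def)
  then have x: "x \<noteq> 0" "edge \<le> \<bar>x\<bar>" "branch N \<sigma> S \<bar>x\<bar> = sgn x * a"
    by (auto simp: pars_iff)
  have le: "s \<le> x\<^sup>2"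
    using power_mono[OF x(2), of 2] edge_nonneg edge_sq assms by simp
  have "\<bar>x\<bar> \<le> sqrt (x\<^sup>2 + 1)" by (rule real_le_rsqrt) simp
  then have "\<bar>closed_loop N a b K\<bar> = sqrt (x\<^sup>2 + 1) - sqrt (x\<^sup>2)"
    using x by (simp add: xS closed_loop_profile abs_mult sgn_real_def)
  also have "\<dots> \<le> sqrt (s + 1) - sqrt s"
    by (rule sqrt_Suc_diff_antimono[OF assms(2) le])
  also have "\<dots> \<le> \<bar>sqrt s - sqrt (s + 1)\<bar>" by simp
  finally show ?thesis .
qed simp

text \<open>The branch of \<open>{}\<close> decreases from a value of at least 1. It is at least
  \<open>sqrt (x\<^sup>2 + 1) - sqrt (x\<^sup>2 - \<sigma> i)\<close>, so adding twice the root of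
  some \<open>i \<in> S\<close> lifts any other branch above 1.\<close>

lemma unique_FNE_nonneg:
  assumes \<sigma>N: "\<And>i. i \<in> {1..N} \<Longrightarrow> \<sigma> i \<ge> 0" and a: "\<bar>a\<bar> < 1"
  shows "\<exists>!K. K \<in> FNE N a b q r"
proof (rule unique_FNE[of 1])
  fix S x assume x: "edge \<le> x" "0 < x" and S: "S \<subseteq> {1..N}" "S \<noteq> {}"
  obtain i where i: "i \<in> S" using S by blast
  then have i': "i \<in> {1..N}" using S by blast
  have sqrt_le: "sqrt (x\<^sup>2 - \<sigma> j) \<le> x" if "j \<in> {1..N}" for j
    using x \<sigma>N[OF that] by (intro real_le_lsqrt) auto
  have "x - sqrt (x\<^sup>2 - \<sigma> i) \<le> (\<Sum>j=1..N. x - sqrt (x\<^sup>2 - \<sigma> j))"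
    using i' sqrt_le by (intro member_le_sum[of i "{1..N}" "\<lambda>j. x - sqrt (x\<^sup>2 - \<sigma> j)"]) auto
  then have "sqrt (x\<^sup>2 + 1) - sqrt (x\<^sup>2 - \<sigma> i) \<le> branch N \<sigma> {} x"
    by (simp add: branch_def)
  moreover have "1 < sqrt (x\<^sup>2 + 1)" using x by simp
  moreover have "sqrt (x\<^sup>2 - \<sigma> i) \<ge> 0" using \<sigma>_le_sq[OF x(1) i'] by simp
  ultimately show "\<bar>a\<bar> < branch N \<sigma> S x"
    using branch_ge_insert[OF S(1) i x(1)] a by linarith
next
  fix x y assume "edge \<le> x" "x < y"
  moreover have "1 * slope N \<sigma> {} x < 0" if "edge < x" for x
  proof -
    have x: "x > 0" using that edge_nonneg by linarith
    have "x < sqrt (x\<^sup>2 + 1)" by (rule real_less_rsqrt) simp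
    then have "x / sqrt (x\<^sup>2 + 1) - 1 < 0"
      using x divide_less_eq_1_pos[of "sqrt (x\<^sup>2 + 1)" x] by linarith
    moreover have "1 - x / sqrt (x\<^sup>2 - \<sigma> j) \<le> 0" if j: "j \<in> {1..N}" for j
    proof -
      have "sqrt (x\<^sup>2 - \<sigma> j) \<le> x" using x \<sigma>N[OF j] by (intro real_le_lsqrt) auto
      moreover have "sqrt (x\<^sup>2 - \<sigma> j) > 0" using \<sigma>_less_sq[OF \<open>edge < x\<close> j] by simp
      ultimately show ?thesis by (simp add: le_divide_eq)
    qed
    then have "(\<Sum>j=1..N. 1 - x / sqrt (x\<^sup>2 - \<sigma> j)) \<le> 0" by (rule sum_nonpos)
    ultimately show ?thesis by (simp add: slope_def)
  qed
  ultimately show "1 * branch N \<sigma> {} y < 1 * branch N \<sigma> {} x"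
    by (intro branch_empty_decreasing)
next
  have 1: "1 \<in> {1..N}" using N by auto
  have edge2: "edge\<^sup>2 = \<sigma> 1" using \<sigma>N[OF 1] edge_sq by simp
  have "sqrt (edge\<^sup>2 - \<sigma> j) \<le> edge" if "j \<in> {1..N}" for j
    using edge_nonneg \<sigma>N[OF that] by (intro real_le_lsqrt) auto
  \<comment> \<open>The root of player 1 vanishes at \<open>edge\<close>, so its summand alone
    offsets the \<open>- edge\<close> in \<open>branch\<close>.\<close>
  then have "edge - sqrt (edge\<^sup>2 - \<sigma> 1) \<le> (\<Sum>j=1..N. edge - sqrt (edge\<^sup>2 - \<sigma> j))"
    using 1 by (intro member_le_sum[of 1 "{1..N}" "\<lambda>j. edge - sqrt (edge\<^sup>2 - \<sigma> j)"]) auto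
  then have "edge \<le> (\<Sum>j=1..N. edge - sqrt (edge\<^sup>2 - \<sigma> j))" by (simp add: edge2)
  moreover have "1 \<le> sqrt (edge\<^sup>2 + 1)" by simp
  moreover have "branch N \<sigma> {} edge =
      sqrt (edge\<^sup>2 + 1) - edge + (\<Sum>j=1..N. edge - sqrt (edge\<^sup>2 - \<sigma> j))"
    by (simp add: branch_def)
  ultimately have "1 \<le> branch N \<sigma> {} edge" by linarith
  then show "\<bar>a\<bar> < 1 * branch N \<sigma> {} edge" using a by simp
qed simp

text \<open>Identifies the slope with the difference of the two sides of the conditions on \<xi> in
  the theorem.\<close>

lemma slope_empty_eq:
  assumes "x > 0"
  shows "slope N \<sigma> {} x =
    (real N - 1) + \<bar>x\<bar> / sqrt (x\<^sup>2 + 1) - (\<Sum>i=1..N. \<bar>x\<bar> / sqrt (x\<^sup>2 - \<sigma> i))"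
  using assms by (simp add: slope_def sum_subtractf)

text \<open>The condition makes the branch of \<open>{}\<close> strictly decreasing, hence positive.
  Up to \<open>edge + 1\<close> its value at \<open>edge + 1\<close> bounds all branches from below;
  beyond, each root is at least 1.\<close>

lemma unique_FNE_decreasing:
  assumes "\<sigma> 1 > 0"
    and cond: "\<And>\<xi>. \<bar>\<xi>\<bar> > sqrt (\<sigma> 1) \<Longrightarrow>
      (real N - 1) + \<bar>\<xi>\<bar> / sqrt (\<xi>\<^sup>2 + 1) < (\<Sum>i=1..N. \<bar>\<xi>\<bar> / sqrt (\<xi>\<^sup>2 - \<sigma> i))"
  shows "\<exists>\<epsilon>>0. \<forall>a. \<bar>a\<bar> < \<epsilon> \<longrightarrow> (\<exists>!K. K \<in> FNE N a b q r)"
proof -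
  have edge: "edge = sqrt (\<sigma> 1)" "edge > 0" using assms by (auto simp: edge_def)
  have "1 * slope N \<sigma> {} x < 0" if "edge < x" for x
    using cond[of x] slope_empty_eq[of x] that edge by simp
  then have anti: "branch N \<sigma> {} y < branch N \<sigma> {} x" if "edge \<le> x" "x < y" for x y
    using branch_empty_decreasing[of 1 x y] that by simp
  have pos: "branch N \<sigma> {} x > 0" if "edge \<le> x" for x
    using anti branch_empty_tendsto_0 that by (rule strict_decreasing_tendsto_0_pos)
  define \<epsilon> where "\<epsilon> = min (branch N \<sigma> {} (edge + 1)) 1"
  have "\<epsilon> > 0" using pos[of "edge + 1"] by (simp add: \<epsilon>_def)
  moreover have "\<exists>!K. K \<in> FNE N a b q r" if a: "\<bar>a\<bar> < \<epsilon>" for a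
  proof (rule unique_FNE[of 1])
    fix S x assume x: "edge \<le> x" "0 < x" and S: "S \<subseteq> {1..N}" "S \<noteq> {}"
    obtain i where i: "i \<in> S" using S by blast
    then have i': "i \<in> {1..N}" using S by blast
    note ge = branch_ge_insert[OF S(1) i x(1)]
    show "\<bar>a\<bar> < branch N \<sigma> S x"
    proof (cases "x \<le> edge + 1")
      case True
      then have "branch N \<sigma> {} (edge + 1) \<le> branch N \<sigma> {} x"
        using anti[OF x(1), of "edge + 1"] by (cases "x = edge + 1") auto
      moreover have "sqrt (x\<^sup>2 - \<sigma> i) \<ge> 0" using \<sigma>_le_sq[OF x(1) i'] by simp
      moreover have "\<bar>a\<bar> < branch N \<sigma> {} (edge + 1)" using a by (simp add: \<epsilon>_def)
      ultimately show ?thesis using ge by linarith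
    next
      case False
      then have "(edge + 1)\<^sup>2 \<le> x\<^sup>2" using edge(2) by (intro power_mono) auto
      then have "1 \<le> x\<^sup>2 - \<sigma> i"
        using \<sigma>_le[OF i'] edge_sq assms(1) edge(2) by (simp add: power2_sum)
      then have "1 \<le> sqrt (x\<^sup>2 - \<sigma> i)" by simp
      moreover have "\<bar>a\<bar> < 1" using a by (simp add: \<epsilon>_def)
      ultimately show ?thesis using ge pos[OF x(1)] by linarith
    qed
  next
    have "\<bar>a\<bar> < branch N \<sigma> {} (edge + 1)" using a by (simp add: \<epsilon>_def)
    also have "\<dots> < branch N \<sigma> {} edge" using anti by simp
    finally show "\<bar>a\<bar> < 1 * branch N \<sigma> {} edge" by simp
  qed (use anti in auto)
  ultimately show ?thesis by blast
qed

text \<open>After splitting off player 1, each summand is smallest at 0.\<close>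

lemma branch_1_ge_0:
  assumes "\<sigma> 1 \<le> 0" "x \<ge> 0"
  shows "branch N \<sigma> {1} 0 \<le> branch N \<sigma> {1} x"
proof -
  have split: "branch N \<sigma> {1} y =
      sqrt (y\<^sup>2 + 1) + sqrt (y\<^sup>2 - \<sigma> 1) + (\<Sum>i\<in>{1..N} - {1}. y - sqrt (y\<^sup>2 - \<sigma> i))" for y
  proof -
    have "(\<Sum>i=1..N. y - (if i \<in> {1} then - 1 else 1) * sqrt (y\<^sup>2 - \<sigma> i)) =
        (y + sqrt (y\<^sup>2 - \<sigma> 1)) +
        (\<Sum>i\<in>{1..N} - {1}. y - (if i \<in> {1} then - 1 else 1) * sqrt (y\<^sup>2 - \<sigma> i))"
      using N by (subst sum.remove[of _ 1]) auto
    also have "(\<Sum>i\<in>{1..N} - {1}. y - (if i \<in> {1} then - 1 else 1) * sqrt (y\<^sup>2 - \<sigma> i)) =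
        (\<Sum>i\<in>{1..N} - {1}. y - sqrt (y\<^sup>2 - \<sigma> i))"
      by (rule sum.cong) auto
    finally show ?thesis by (simp add: branch_def)
  qed
  have "0 - sqrt (0\<^sup>2 - \<sigma> i) \<le> x - sqrt (x\<^sup>2 - \<sigma> i)" if "i \<in> {1..N}" for i
    using abs_diff_sqrt_le[OF assms(2), of "\<sigma> i"] \<sigma>_le[OF that] assms(1)
      order_trans[of "\<sigma> i" 0 "x\<^sup>2"] by auto
  then have "(\<Sum>i\<in>{1..N} - {1}. 0 - sqrt (0\<^sup>2 - \<sigma> i)) \<le> (\<Sum>i\<in>{1..N} - {1}. x - sqrt (x\<^sup>2 - \<sigma> i))"
    by (intro sum_mono) auto
  moreover have "sqrt (0\<^sup>2 + 1) \<le> sqrt (x\<^sup>2 + 1)" "sqrt (0\<^sup>2 - \<sigma> 1) \<le> sqrt (x\<^sup>2 - \<sigma> 1)"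
    by (simp_all del: real_sqrt_one)
  ultimately show ?thesis unfolding split by linarith
qed

text \<open>The slope of the branch of \<open>{}\<close> never vanishes, so it has constant sign.
  All other branches lie above that of \<open>{1}\<close>, since player 1 has the smallest root, and
  \<open>branch_1_ge_0\<close> bounds that one below by its value at 0.\<close>

lemma unique_FNE_nonpos:
  assumes \<sigma>1: "\<sigma> 1 \<le> 0"
    and sum: "(\<Sum>i=2..N. sqrt (- \<sigma> i)) - sqrt (- \<sigma> 1) < 1"
    and cond: "\<And>\<xi>. \<xi> \<noteq> 0 \<Longrightarrow>
      (real N - 1) + \<bar>\<xi>\<bar> / sqrt (\<xi>\<^sup>2 + 1) \<noteq> (\<Sum>i=1..N. \<bar>\<xi>\<bar> / sqrt (\<xi>\<^sup>2 - \<sigma> i))"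
  shows "\<exists>\<epsilon>>0. \<forall>a. \<bar>a\<bar> < \<epsilon> \<longrightarrow> (\<exists>!K. K \<in> FNE N a b q r)"
proof -
  have edge: "edge = 0" using \<sigma>1 by (simp add: edge_def)
  have nz: "slope N \<sigma> {} x \<noteq> 0" if "x > 0" for x
    using cond[of x] that by (simp add: slope_empty_eq)
  have cont: "continuous_on {0<..} (slope N \<sigma> {})"
  proof -
    have "sqrt (x\<^sup>2 - \<sigma> i) \<noteq> 0" if "x > 0" "i \<in> {1..N}" for x i
      using \<sigma>_less_sq[of x i] that edge by auto
    moreover have "sqrt (x\<^sup>2 + 1) \<noteq> 0" for x :: real
      by (metis add_nonneg_pos less_irrefl real_sqrt_eq_0_iff zero_le_power2 zero_less_one)
    ultimately show ?thesis unfolding slope_def by (intro continuous_intros) auto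
  qed
  obtain e :: real where e: "e = 1 \<or> e = - 1" and neg: "\<And>x. x > 0 \<Longrightarrow> e * slope N \<sigma> {} x < 0"
  proof -
    define e where "e = - sgn (slope N \<sigma> {} 1)"
    have "e * slope N \<sigma> {} x < 0" if "x > 0" for x
    proof (rule ccontr)
      assume "\<not> e * slope N \<sigma> {} x < 0"
      moreover have "e * slope N \<sigma> {} 1 < 0"
        using nz[of 1] by (auto simp: e_def sgn_real_def)
      \<comment> \<open>A sign change would force a zero of the slope on the connected
        half-line.\<close>
      moreover have "connected ((\<lambda>x. e * slope N \<sigma> {} x) ` {0<..})"
        by (intro connected_continuous_image continuous_intros cont) auto
      ultimately have "0 \<in> (\<lambda>x. e * slope N \<sigma> {} x) ` {0<..}"
        using that connectedD_interval[of _ "e * slope N \<sigma> {} 1" "e * slope N \<sigma> {} x" 0]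
        by force
      then show False using nz nz[of 1] by (auto simp: e_def sgn_real_def split: if_splits)
    qed
    moreover have "e = 1 \<or> e = - 1" using nz[of 1] by (auto simp: e_def sgn_real_def)
    ultimately show ?thesis using that by blast
  qed
  have anti: "e * branch N \<sigma> {} y < e * branch N \<sigma> {} x" if "edge \<le> x" "x < y" for x y
    using branch_empty_decreasing[of e x y] neg that edge by simp
  have "((\<lambda>x. e * branch N \<sigma> {} x) \<longlongrightarrow> e * 0) at_top"
    by (intro tendsto_intros branch_empty_tendsto_0)
  then have pos: "e * branch N \<sigma> {} edge > 0"
    using anti by (intro strict_decreasing_tendsto_0_pos[of edge]) auto
  \<comment> \<open>This is the hypothesis on the sum of roots, rearranged.\<close>
  have pos1: "branch N \<sigma> {1} 0 > 0"
  proof -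
    have 1: "{1..N} = insert 1 {2..N}" using N by auto
    have "(\<Sum>i=1..N. 0 - (if i \<in> {1} then - 1 else 1) * sqrt (- \<sigma> i)) =
        sqrt (- \<sigma> 1) + (\<Sum>i=2..N. 0 - (if i \<in> {1} then - 1 else 1) * sqrt (- \<sigma> i))"
      unfolding 1 by (subst sum.insert) auto
    also have "(\<Sum>i=2..N. 0 - (if i \<in> {1} then - 1 else 1) * sqrt (- \<sigma> i)) =
        (\<Sum>i=2..N. - sqrt (- \<sigma> i))"
      by (rule sum.cong) auto
    finally show ?thesis using sum by (simp add: branch_def sum_negf)
  qed
  define \<epsilon> where "\<epsilon> = min (e * branch N \<sigma> {} edge) (branch N \<sigma> {1} 0)"
  have "\<epsilon> > 0" using pos pos1 by (simp add: \<epsilon>_def)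
  moreover have "\<exists>!K. K \<in> FNE N a b q r" if a: "\<bar>a\<bar> < \<epsilon>" for a
  proof (rule unique_FNE[OF e])
    fix S x assume x: "edge \<le> x" "0 < x" and S: "S \<subseteq> {1..N}" "S \<noteq> {}"
    obtain i where i: "i \<in> S" using S by blast
    then have i': "i \<in> {1..N}" using S by blast
    have 1: "{1} \<subseteq> {1..N}" using N by auto
    have "\<bar>a\<bar> < branch N \<sigma> {1} 0" using a by (simp add: \<epsilon>_def)
    also have "\<dots> \<le> branch N \<sigma> {1} x" using branch_1_ge_0[OF \<sigma>1] x by simp
    also have "\<dots> = branch N \<sigma> {} x + 2 * sqrt (x\<^sup>2 - \<sigma> 1)" by (subst branch_eq[OF 1]) simp
    also have "\<dots> \<le> branch N \<sigma> {} x + 2 * sqrt (x\<^sup>2 - \<sigma> i)" using \<sigma>_le[OF i'] by simp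
    also have "\<dots> \<le> branch N \<sigma> S x" by (rule branch_ge_insert[OF S(1) i x(1)])
    finally show "\<bar>a\<bar> < branch N \<sigma> S x" .
  next
    show "\<bar>a\<bar> < e * branch N \<sigma> {} edge" using a by (simp add: \<epsilon>_def)
  qed (use anti in auto)
  ultimately show ?thesis by blast
qed

section \<open>Nonexistence, and assembly of the claims\<close>

text \<open>The height 1 is skipped: the branch of \<open>{}\<close> is
  \<open>sqrt (x\<^sup>2 + 1) - \<bar>x\<bar> < 1\<close>, and every other one is at least
  \<open>sqrt (x\<^sup>2 + 1) + \<bar>x\<bar> > 1\<close>.\<close>

lemma FNE_empty:
  assumes \<sigma>0: "\<And>i. i \<in> {1..N} \<Longrightarrow> \<sigma> i = 0" and a: "\<bar>a\<bar> = 1"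
  shows "FNE N a b q r = {}"
proof -
  have "(x, S) \<notin> pars N \<sigma> a" for x S
  proof
    assume "(x, S) \<in> pars N \<sigma> a"
    then have x: "x \<noteq> 0" and S: "S \<subseteq> {1..N}" and br: "branch N \<sigma> S \<bar>x\<bar> = sgn x * a"
      by (auto simp: pars_iff)
    have abs: "\<bar>branch N \<sigma> S \<bar>x\<bar>\<bar> = 1" using x a by (simp add: br abs_mult sgn_real_def)
    have "(\<Sum>i=1..N. \<bar>x\<bar> - sqrt (x\<^sup>2 - \<sigma> i)) = 0" using \<sigma>0 by (intro sum.neutral) auto
    then have empty: "branch N \<sigma> {} \<bar>x\<bar> = sqrt (x\<^sup>2 + 1) - \<bar>x\<bar>"
      by (simp add: branch_def)
    have lt: "1 < sqrt (x\<^sup>2 + 1)" using x by simp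
    show False
    proof (cases "S = {}")
      case True
      moreover have "\<bar>sgn x\<bar> = 1" using x by (simp add: sgn_real_def)
      ultimately show ?thesis using abs empty loop_equation(3)[OF x]
        by (simp only: abs_mult)
    next
      case False
      then obtain i where i: "i \<in> S" by blast
      have "edge \<le> \<bar>x\<bar>" using \<sigma>0[of 1] N by (simp add: edge_def)
      from branch_ge_insert[OF S i this]
      have "sqrt (x\<^sup>2 + 1) - \<bar>x\<bar> + 2 * \<bar>x\<bar> \<le> branch N \<sigma> S \<bar>x\<bar>"
        using \<sigma>0[of i] i S empty by auto
      then show ?thesis using lt abs by linarith
    qed
  qed
  then have "pars N \<sigma> a = {}" by auto
  moreover have "a \<noteq> 0" using a by auto
  ultimately show ?thesis
    using bij_betw_profile_nonzero[of a] by (simp add: bij_betw_def)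
qed

end

theorem theorem2:
  fixes N :: nat and b q r \<sigma> :: "nat \<Rightarrow> real"
  assumes "N \<ge> 1"
    and "\<And>i. i \<in> {1..N} \<Longrightarrow> b i \<noteq> 0"
    and "\<And>i. i \<in> {1..N} \<Longrightarrow> r i > 0"
    and "\<And>i. i \<in> {1..N} \<Longrightarrow> \<sigma> i = (b i)\<^sup>2 * q i / r i"
    and "\<And>i j. 1 \<le> i \<Longrightarrow> i \<le> j \<Longrightarrow> j \<le> N \<Longrightarrow> \<sigma> i \<ge> \<sigma> j"
    and "\<sigma> N > -1"
  shows
    "(\<exists>A>0. \<forall>a. \<bar>a\<bar> > A \<longrightarrow> card (FNE N a b q r) = 2 ^ N - 1)
   \<and> (\<sigma> 1 > 0 \<longrightarrow> (\<forall>a. FNE N a b q r \<noteq> {}))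
   \<and> (let D = {j \<in> {1..N}. \<sigma> j > 0 \<and> (\<forall>i\<in>{1..N}. i \<noteq> j \<longrightarrow> \<sigma> j \<noteq> \<sigma> i)};
          \<sigma>b = Max (\<sigma> ` D)
      in \<sigma> 1 > 0 \<and> D \<noteq> {} \<longrightarrow>
           (\<forall>a. \<forall>K \<in> FNE N a b q r.
              \<bar>closed_loop N a b K\<bar> \<le> \<bar>sqrt \<sigma>b - sqrt (\<sigma>b + 1)\<bar>))
   \<and> (\<sigma> N \<ge> 0 \<longrightarrow> (\<forall>a. \<bar>a\<bar> < 1 \<longrightarrow> (\<exists>!K. K \<in> FNE N a b q r)))
   \<and> (\<sigma> N < 0 \<and> \<sigma> 1 > 0 \<and> \<sigma> 1 > \<sigma> 2
      \<and> (\<Sum>i=2..N. sqrt (\<sigma> 1 - \<sigma> i)) < (real N - 1) * sqrt (\<sigma> 1) + sqrt (\<sigma> 1 + 1)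
      \<and> (\<forall>\<xi>::real. \<bar>\<xi>\<bar> > sqrt (\<sigma> 1) \<longrightarrow>
           (real N - 1) + \<bar>\<xi>\<bar> / sqrt (\<xi>\<^sup>2 + 1) < (\<Sum>i=1..N. \<bar>\<xi>\<bar> / sqrt (\<xi>\<^sup>2 - \<sigma> i)))
      \<longrightarrow> (\<exists>\<epsilon>>0. \<forall>a. \<bar>a\<bar> < \<epsilon> \<longrightarrow> (\<exists>!K. K \<in> FNE N a b q r)))
   \<and> (\<sigma> 1 \<le> 0
      \<and> (\<Sum>i=2..N. sqrt (- \<sigma> i)) - sqrt (- \<sigma> 1) < 1
      \<and> (\<forall>\<xi>::real. \<xi> \<noteq> 0 \<longrightarrow>
           (real N - 1) + \<bar>\<xi>\<bar> / sqrt (\<xi>\<^sup>2 + 1) \<noteq> (\<Sum>i=1..N. \<bar>\<xi>\<bar> / sqrt (\<xi>\<^sup>2 - \<sigma> i)))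
      \<longrightarrow> (\<exists>\<epsilon>>0. \<forall>a. \<bar>a\<bar> < \<epsilon> \<longrightarrow> (\<exists>!K. K \<in> FNE N a b q r)))
   \<and> ((\<forall>i\<in>{1..N}. \<sigma> i = 0) \<longrightarrow> (\<forall>a. \<bar>a\<bar> = 1 \<longrightarrow> FNE N a b q r = {}))"
proof -
  have \<sigma>_ge_N: "\<sigma> N \<le> \<sigma> i" if "i \<in> {1..N}" for i
    using assms(5)[of i N] that by auto
  have \<sigma>_le_1: "\<sigma> i \<le> \<sigma> 1" if "i \<in> {1..N}" for i
    using assms(5)[of 1 i] that by auto
  interpret scalar_lq_game N b q r \<sigma>
    using assms(1-4,6) \<sigma>_le_1 \<sigma>_ge_N by unfold_locales (auto intro: less_le_trans)
  have iii: "let D = {j \<in> {1..N}. \<sigma> j > 0 \<and> (\<forall>i\<in>{1..N}. i \<noteq> j \<longrightarrow> \<sigma> j \<noteq> \<sigma> i)};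
          \<sigma>b = Max (\<sigma> ` D)
      in \<sigma> 1 > 0 \<and> D \<noteq> {} \<longrightarrow>
           (\<forall>a. \<forall>K \<in> FNE N a b q r.
              \<bar>closed_loop N a b K\<bar> \<le> \<bar>sqrt \<sigma>b - sqrt (\<sigma>b + 1)\<bar>)"
    unfolding Let_def
  proof (intro impI allI ballI)
    fix a K
    let ?D = "{j \<in> {1..N}. \<sigma> j > 0 \<and> (\<forall>i\<in>{1..N}. i \<noteq> j \<longrightarrow> \<sigma> j \<noteq> \<sigma> i)}"
    assume D: "\<sigma> 1 > 0 \<and> ?D \<noteq> {}" and K: "K \<in> FNE N a b q r"
    \<comment> \<open>The maximum over a finite nonempty set is attained, so it is some positive
      \<open>\<sigma> j \<le> \<sigma> 1\<close>.\<close>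
    then have "Max (\<sigma> ` ?D) \<in> \<sigma> ` ?D" by (intro Max_in) auto
    then obtain j where "j \<in> ?D" "Max (\<sigma> ` ?D) = \<sigma> j" by blast
    then show "\<bar>closed_loop N a b K\<bar> \<le> \<bar>sqrt (Max (\<sigma> ` ?D)) - sqrt (Max (\<sigma> ` ?D) + 1)\<bar>"
      using D K \<sigma>_le_1[of j] by (simp only:) (intro abs_closed_loop_le; simp)
  qed
  have iv: "\<sigma> N \<ge> 0 \<longrightarrow> (\<forall>a. \<bar>a\<bar> < 1 \<longrightarrow> (\<exists>!K. K \<in> FNE N a b q r))"
  proof (intro impI allI)
    fix a :: real assume "\<sigma> N \<ge> 0" "\<bar>a\<bar> < 1"
    moreover from this have "\<sigma> i \<ge> 0" if "i \<in> {1..N}" for i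
      using \<sigma>_ge_N[OF that] by linarith
    ultimately show "\<exists>!K. K \<in> FNE N a b q r" by (intro unique_FNE_nonneg)
  qed
  show ?thesis
  proof (intro conjI iii iv card_FNE_large)
    show "\<sigma> 1 > 0 \<longrightarrow> (\<forall>a. FNE N a b q r \<noteq> {})"
      using FNE_nonempty by blast
  next
    show "(\<forall>i\<in>{1..N}. \<sigma> i = 0) \<longrightarrow> (\<forall>a. \<bar>a\<bar> = 1 \<longrightarrow> FNE N a b q r = {})"
      using FNE_empty by blast
  qed (intro impI, elim conjE, rule unique_FNE_decreasing, assumption, blast,
      intro impI, elim conjE, rule unique_FNE_nonpos, assumption, assumption, blast)
qed

end
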